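(* Let $P=(p_{ij})$ be an irreducible stochastic transition matrix on $X=\mathbb{Z}_+=\{0,1,2,\dots\}$ with $p_{ij}=0$ whenever $j-i\geq2$, and let $\Phi$ be the corresponding Markov chain. With $F_n^{(i)}$, $m_{i0}^{(\ell)}$, $d_i^{(\ell)}$, $d^{(\ell)}$, $\xi$ and $\sigma_2=\ell d^{(\ell)}$ as defined in the context, we have for all $i\geq1$ and $\ell\geq1$ $$m_{i0}^{(0)}=\sum_{j=0}^{i-1}F_j^{(0)}\,\xi-\sum_{j=1}^{i-1}F_j^{(0)},$$ $$m_{i0}^{(\ell)}=\ell\sum_{j=0}^{i-1}\left(F_j^{(0)}d^{(\ell)}-d_j^{(\ell)}\right),$$ and $$m_{00}^{(0)}=p_{01}\xi+p_{00},\qquad m_{00}^{(\ell)}=p_{01}\sigma_2+\ell\,m_{00}^{(\ell-1)}.$$ Moreover, the chain is transient if and only if $\xi<1$; and the chain is $\ell$-transient if and only if $\xi<1$ and $\sigma_2<\infty$.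
   Context: Notation. For $0\leq i<n$ put $p_n^{(i)}=\sum_{k=0}^{i}p_{nk}$, and define inductively $F_n^{(n)}=1$ and $F_n^{(i)}=\sum_{k=i}^{n-1}\frac{p_n^{(k)}F_k^{(i)}}{p_{n,n+1}}$ for $0\le i<n$ (irreducibility gives $p_{n,n+1}>0$). Let $\tau_0=\inf\{n\geq1:\Phi_n=0\}$ and $f_{i0}^{(n)}=\mathbb{P}_i\{\tau_0=n\}$, where $\mathbb{P}_i$ is the law with $\Phi_0=i$. For $i\geq0$ and integers $\ell\geq1$ let $$m_{i0}^{(0)}=\sum_{n=1}^{\infty}f_{i0}^{(n)},\qquad m_{i0}^{(\ell)}=\sum_{n=1}^{\infty}n(n+1)\cdots(n+\ell-1)f_{i0}^{(n)},$$ $$d_0^{(\ell)}=0,\qquad d_i^{(\ell)}=\sum_{k=1}^{i}\frac{F_i^{(k)}m_{k0}^{(\ell-1)}}{p_{k,k+1}}\ (i\ge1),\qquad d^{(\ell)}=\sup_{i\geq1}\frac{\sum_{j=0}^{i-1}d_j^{(\ell)}}{\sum_{j=0}^{i-1}F_j^{(0)}},$$ $$\xi=\sup_{i\geq2}\frac{\sum_{j=1}^{i-1}F_j^{(0)}}{\sum_{j=0}^{i-1}F_j^{(0)}},\qquad \sigma_2=\ell d^{(\ell)}.$$ All these quantities take values in $[0,\infty]$; when $d^{(\ell)}=\infty$ the right-hand side of the formula for $m_{i0}^{(\ell)}$, $i\ge 1$, is understood to be $+\infty$. Transience of an irreducible chain on a countable space has its usual meaning. For an integer $\ell\ge1$,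 a nonempty set $A\subset X$ is uniformly $\ell$-transient if $\sup_{x\in A}\sum_{n=1}^{\infty}n^{\ell}P^{n}(x,A)<\infty$, where $P^n(x,A)=\mathbb{P}_x\{\Phi_n\in A\}$; the chain is $\ell$-transient if it is irreducible and $X$ can be covered by countably many uniformly $\ell$-transient sets. (In general the cover is only required up to a set null for a maximal irreducibility measure $\psi$; here $\psi$ is equivalent to counting measure.) *)

theory Defs
  imports "HOL-Probability.Probability"
begin

definition stochastic :: "(nat \<Rightarrow> nat \<Rightarrow> real) \<Rightarrow> bool" where
  "stochastic P \<longleftrightarrow> (\<forall>i j. 0 \<le> P i j) \<and> (\<forall>i. (\<lambda>j. P i j) sums 1)"

primrec mat_power :: "(nat \<Rightarrow> nat \<Rightarrow> real) \<Rightarrow> nat \<Rightarrow> nat \<Rightarrow> nat \<Rightarrow> real" where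
  "mat_power P 0 i j = (if i = j then 1 else 0)"
| "mat_power P (Suc n) i j = (\<Sum>k. P i k * mat_power P n k j)"

definition irreducible_matrix :: "(nat \<Rightarrow> nat \<Rightarrow> real) \<Rightarrow> bool" where
  "irreducible_matrix P \<longleftrightarrow> (\<forall>i j. \<exists>n. mat_power P n i j > 0)"

text \<open>\<open>M i\<close> is the law of the chain started at \<open>i\<close>; all these laws live on an
  arbitrary sample space carrying the one process \<open>\<Phi>\<close>.\<close>

definition markov_chain ::
  "(nat \<Rightarrow> nat \<Rightarrow> real) \<Rightarrow> (nat \<Rightarrow> 'w measure) \<Rightarrow> (nat \<Rightarrow> 'w \<Rightarrow> nat) \<Rightarrow> bool" where
  "markov_chain P M \<Phi> \<longleftrightarrow>
    (\<forall>i. prob_space (M i) \<and>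
      (\<forall>n. \<Phi> n \<in> measurable (M i) (count_space UNIV)) \<and>
      \<P>(\<omega> in M i. \<Phi> 0 \<omega> = i) = 1 \<and>
      (\<forall>n x. \<P>(\<omega> in M i. \<forall>k\<le>n. \<Phi> k \<omega> = x k) > 0 \<longrightarrow>
        \<P>(\<omega> in M i. \<Phi> (Suc n) \<omega> = x (Suc n) \<bar> \<forall>k\<le>n. \<Phi> k \<omega> = x k) = P (x n) (x (Suc n))))"

definition nstep :: "(nat \<Rightarrow> 'w measure) \<Rightarrow> (nat \<Rightarrow> 'w \<Rightarrow> nat) \<Rightarrow> nat \<Rightarrow> nat \<Rightarrow> nat set \<Rightarrow> real" where
  "nstep M \<Phi> n x A = \<P>(\<omega> in M x. \<Phi> n \<omega> \<in> A)"

definition hit_time :: "(nat \<Rightarrow> 'w \<Rightarrow> nat) \<Rightarrow> nat \<Rightarrow> 'w \<Rightarrow> enat" where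
  "hit_time \<Phi> y \<omega> = Inf {enat n | n. n \<ge> 1 \<and> \<Phi> n \<omega> = y}"

definition first_hit :: "(nat \<Rightarrow> 'w measure) \<Rightarrow> (nat \<Rightarrow> 'w \<Rightarrow> nat) \<Rightarrow> nat \<Rightarrow> nat \<Rightarrow> real" where
  "first_hit M \<Phi> i n = \<P>(\<omega> in M i. hit_time \<Phi> 0 \<omega> = enat n)"

definition transient_chain :: "(nat \<Rightarrow> 'w measure) \<Rightarrow> (nat \<Rightarrow> 'w \<Rightarrow> nat) \<Rightarrow> bool" where
  "transient_chain M \<Phi> \<longleftrightarrow> (\<forall>i. \<P>(\<omega> in M i. hit_time \<Phi> i \<omega> < \<infinity>) < 1)"

definition uniformly_transient ::
  "(nat \<Rightarrow> 'w measure) \<Rightarrow> (nat \<Rightarrow> 'w \<Rightarrow> nat) \<Rightarrow> nat \<Rightarrow> nat set \<Rightarrow> bool" where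
  "uniformly_transient M \<Phi> l A \<longleftrightarrow> A \<noteq> {} \<and>
    (SUP x\<in>A. \<Sum>n. ereal (real (Suc n) ^ l * nstep M \<Phi> (Suc n) x A)) < \<infinity>"

definition l_transient_chain ::
  "(nat \<Rightarrow> nat \<Rightarrow> real) \<Rightarrow> (nat \<Rightarrow> 'w measure) \<Rightarrow> (nat \<Rightarrow> 'w \<Rightarrow> nat) \<Rightarrow> nat \<Rightarrow> bool" where
  "l_transient_chain P M \<Phi> l \<longleftrightarrow> irreducible_matrix P \<and>
    (\<exists>\<A>. countable \<A> \<and> \<Union>\<A> = UNIV \<and> (\<forall>A\<in>\<A>. uniformly_transient M \<Phi> l A))"

definition row_sum :: "(nat \<Rightarrow> nat \<Rightarrow> real) \<Rightarrow> nat \<Rightarrow> nat \<Rightarrow> real" where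
  "row_sum P n i = (\<Sum>k=0..i. P n k)"

text \<open>\<open>F_coeff P n i\<close> is $F_n^{(i)}$; only \<open>i \<le> n\<close> is meaningful.\<close>

function F_coeff :: "(nat \<Rightarrow> nat \<Rightarrow> real) \<Rightarrow> nat \<Rightarrow> nat \<Rightarrow> real" where
  "F_coeff P n i =
    (if n = i then 1 else (\<Sum>k=i..<n. row_sum P n k * F_coeff P k i / P n (Suc n)))"
  by auto
termination by (relation "Wellfounded.measure (\<lambda>(P, n, i). n)") auto

declare F_coeff.simps [simp del]

text \<open>The rising factorial $n(n+1)\cdots(n+l-1)$ is \<open>pochhammer n l\<close>, which is 1 for
  \<open>l = 0\<close>, so \<open>hit_moment M \<Phi> i l\<close> is $m_{i0}^{(l)}$ for every \<open>l \<ge> 0\<close>.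
  The series starts at 1, hence the index shift.\<close>

definition hit_moment :: "(nat \<Rightarrow> 'w measure) \<Rightarrow> (nat \<Rightarrow> 'w \<Rightarrow> nat) \<Rightarrow> nat \<Rightarrow> nat \<Rightarrow> ereal" where
  "hit_moment M \<Phi> i l = (\<Sum>n. ereal (pochhammer (real (Suc n)) l * first_hit M \<Phi> i (Suc n)))"

text \<open>\<open>d_coeff P M \<Phi> l i\<close> is $d_i^{(l)}$ and \<open>d_sup P M \<Phi> l\<close> is $d^{(l)}$, for \<open>l \<ge> 1\<close>; the
  sum is empty for \<open>i = 0\<close>.  In type \<open>ereal\<close>, $0 \cdot \infty = 0$.\<close>

definition d_coeff ::
  "(nat \<Rightarrow> nat \<Rightarrow> real) \<Rightarrow> (nat \<Rightarrow> 'w measure) \<Rightarrow> (nat \<Rightarrow> 'w \<Rightarrow> nat) \<Rightarrow> nat \<Rightarrow> nat \<Rightarrow> ereal" where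
  "d_coeff P M \<Phi> l i =
    (\<Sum>k=1..i. ereal (F_coeff P i k) * hit_moment M \<Phi> k (l - 1) / ereal (P k (Suc k)))"

definition d_sup ::
  "(nat \<Rightarrow> nat \<Rightarrow> real) \<Rightarrow> (nat \<Rightarrow> 'w measure) \<Rightarrow> (nat \<Rightarrow> 'w \<Rightarrow> nat) \<Rightarrow> nat \<Rightarrow> ereal" where
  "d_sup P M \<Phi> l =
    (SUP i\<in>{1..}. (\<Sum>j=0..<i. d_coeff P M \<Phi> l j) / ereal (\<Sum>j=0..<i. F_coeff P j 0))"

definition xi :: "(nat \<Rightarrow> nat \<Rightarrow> real) \<Rightarrow> ereal" where
  "xi P = (SUP i\<in>{2..}. ereal ((\<Sum>j=1..<i. F_coeff P j 0) / (\<Sum>j=0..<i. F_coeff P j 0)))"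

definition sigma2 ::
  "(nat \<Rightarrow> nat \<Rightarrow> real) \<Rightarrow> (nat \<Rightarrow> 'w measure) \<Rightarrow> (nat \<Rightarrow> 'w \<Rightarrow> nat) \<Rightarrow> nat \<Rightarrow> ereal" where
  "sigma2 P M \<Phi> l = ereal (real l) * d_sup P M \<Phi> l"

end

theory Submission
  imports Defs
begin

text \<open>
  Because upward jumps have size one, an equation \<open>x = Q x + g\<close> on the states \<open>i \<ge> 1\<close>, with
  \<open>Q\<close> the transition matrix killed at \<open>0\<close> and \<open>x\<^sub>0 = 0\<close>, is a recursion for the increments
  of \<open>x\<close>, solved by \<open>x\<^sub>n\<^sub>+\<^sub>1 - x\<^sub>n = F\<^sub>n x\<^sub>1 - D\<^sub>n\<close>, where \<open>F\<^sub>n\<close> has upper index \<open>0\<close> and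
  \<open>D\<^sub>n\<close> is linear in \<open>g\<close>.  The solution is nonnegative iff \<open>x\<^sub>1\<close> dominates every ratio of
  partial sums of \<open>D\<close> and \<open>F\<close>.  By \<open>(n+1)\<cdots>(n+l) = n\<cdots>(n+l-1) + l (n+1)\<cdots>(n+l-1)\<close>, first-step
  analysis makes the \<open>l\<close>-th moment the minimal nonnegative solution for \<open>g\<close> equal to \<open>l\<close> times
  the \<open>(l-1)\<close>-th moment, so its value at \<open>1\<close> is the supremum of these ratios.  The hitting
  probability is the case of the source \<open>g\<^sub>i = p\<^sub>i\<^sub>0\<close>, for which \<open>D\<^sub>n = F\<^sub>n\<close> when \<open>n \<ge> 1\<close>.
  For the transience criteria, the renewal equation at \<open>0\<close> shows that the return probabilities have
  a finite \<open>l\<close>-th moment iff the first return law is defective and has a finite \<open>l\<close>-th moment.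
\<close>

subsection \<open>Skip-free matrices\<close>

lemma F_coeff_diag [simp]: "F_coeff P n n = 1"
  by (subst F_coeff.simps) simp

lemma F_coeff_nonneg:
  assumes "\<And>i j. 0 \<le> P i j" and "i \<le> n"
  shows "0 \<le> F_coeff P n i"
  using assms(2)
proof (induction n rule: less_induct)
  case (less n)
  have "0 \<le> row_sum P n k * F_coeff P k i / P n (Suc n)" if "k \<in> {i..<n}" for k
    using that less assms(1) by (auto simp: row_sum_def intro!: divide_nonneg_nonneg mult_nonneg_nonneg sum_nonneg)
  then show ?case
    by (subst F_coeff.simps) (auto intro!: sum_nonneg)
qed

text \<open>Indices are shifted: the passage counted by \<open>first_passage P y n i\<close> happens at time \<open>n + 1\<close>.\<close>

primrec first_passage :: "(nat \<Rightarrow> nat \<Rightarrow> real) \<Rightarrow> nat \<Rightarrow> nat \<Rightarrow> nat \<Rightarrow> real" where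
  "first_passage P y 0 i = P i y"
| "first_passage P y (Suc n) i = (\<Sum>k\<in>{..Suc i} - {y}. P i k * first_passage P y n k)"

text \<open>A Duhamel sum: column \<open>k\<close> of \<open>F_coeff\<close> is the response of the
  homogeneous recursion to a unit start at \<open>k\<close>, and the source enters there with size
  \<open>g k / P k (Suc k)\<close>. For a finite moment as \<open>g\<close> it becomes
  \<open>d_coeff\<close> of the next order.\<close>

definition green_coeff :: "(nat \<Rightarrow> nat \<Rightarrow> real) \<Rightarrow> (nat \<Rightarrow> real) \<Rightarrow> nat \<Rightarrow> real" where
  "green_coeff P g j = (\<Sum>k=1..j. F_coeff P j k * g k / P k (Suc k))"

lemma sum_triangle_swap:
  fixes b :: "nat \<Rightarrow> nat \<Rightarrow> 'a::comm_monoid_add"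
  shows "(\<Sum>k=m..n. \<Sum>j=k..n. b k j) = (\<Sum>j=m..n. \<Sum>k=m..j. b k j)"
proof -
  have "(\<Sum>k=m..n. \<Sum>j=k..n. b k j) = (\<Sum>k=m..n. \<Sum>j | j \<in> {m..n} \<and> k \<le> j. b k j)"
    by (intro sum.cong) auto
  also have "\<dots> = (\<Sum>j=m..n. \<Sum>k | k \<in> {m..n} \<and> k \<le> j. b k j)"
    by (intro sum.swap_restrict) auto
  also have "\<dots> = (\<Sum>j=m..n. \<Sum>k=m..j. b k j)"
    by (intro sum.cong) auto
  finally show ?thesis .
qed

locale skip_free =
  fixes P :: "nat \<Rightarrow> nat \<Rightarrow> real"
  assumes stochastic: "stochastic P"
    and irreducible: "irreducible_matrix P"
    and skip_free: "\<And>i j. j \<ge> i + 2 \<Longrightarrow> P i j = 0"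
begin

lemma nonneg [simp]: "0 \<le> P i j"
  using stochastic by (simp add: stochastic_def)

lemma row_sum_1: "(\<Sum>k\<le>Suc i. P i k) = 1"
proof -
  have "(\<lambda>j. P i j) sums 1"
    using stochastic by (simp add: stochastic_def)
  moreover have "(\<lambda>j. P i j) sums (\<Sum>k\<le>Suc i. P i k)"
    using skip_free by (intro sums_finite) auto
  ultimately show ?thesis
    using sums_unique2 by blast
qed

lemma mat_power_Suc: "mat_power P (Suc n) i j = (\<Sum>k\<le>Suc i. P i k * mat_power P n k j)"
  using skip_free by (simp del: sum.atMost_Suc) (intro suminf_finite, auto)

lemma mat_power_nonneg [simp]: "0 \<le> mat_power P n i j"
proof (induction n arbitrary: i)
  case (Suc n)
  then show ?case
    unfolding mat_power_Suc by (intro sum_nonneg mult_nonneg_nonneg) auto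
qed simp

text \<open>One intermediate state of the Chapman-Kolmogorov sum is kept; this is enough to compare
  the return probabilities of different states.\<close>

lemma mat_power_add_ge: "mat_power P m i k * mat_power P n k j \<le> mat_power P (m + n) i j"
proof (induction m arbitrary: i)
  case (Suc m)
  have "mat_power P (Suc m) i k * mat_power P n k j
      = (\<Sum>x\<le>Suc i. P i x * (mat_power P m x k * mat_power P n k j))"
    by (simp add: mat_power_Suc sum_distrib_right sum_distrib_left mult_ac del: mat_power.simps sum.atMost_Suc)
  also have "\<dots> \<le> (\<Sum>x\<le>Suc i. P i x * mat_power P (m + n) x j)"
    by (intro sum_mono mult_left_mono Suc.IH) auto
  finally show ?case
    by (simp add: mat_power_Suc del: mat_power.simps sum.atMost_Suc)
qed simp

text \<open>Otherwise no path could leave the states up to \<open>n\<close> upwards, against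
  irreducibility.\<close>

lemma upward_pos: "0 < P n (Suc n)"
proof (rule ccontr)
  assume "\<not> 0 < P n (Suc n)"
  then have 0: "P n (Suc n) = 0"
    using nonneg[of n "Suc n"] by linarith
  have "mat_power P m i j = 0" if "i \<le> n" "n < j" for m i j
    using that
  proof (induction m arbitrary: i)
    case (Suc m)
    have "P i k * mat_power P m k j = 0" if "k \<le> Suc i" for k
    proof (cases "k \<le> n")
      case False
      then have "i = n" "k = Suc n" using that Suc.prems by auto
      then show ?thesis using 0 by simp
    qed (use Suc in simp)
    then show ?case
      unfolding mat_power_Suc by (intro sum.neutral) auto
  qed simp
  then show False
    using irreducible unfolding irreducible_matrix_def by (metis le_refl less_irrefl lessI)
qed

lemma F_nonneg: "i \<le> n \<Longrightarrow> 0 \<le> F_coeff P n i"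
  by (rule F_coeff_nonneg) auto

lemma row_sum_nonneg: "0 \<le> row_sum P n k"
  by (auto simp: row_sum_def intro: sum_nonneg)

lemma F_coeff_rec:
  "i < n \<Longrightarrow> P n (Suc n) * F_coeff P n i = (\<Sum>k=i..<n. row_sum P n k * F_coeff P k i)"
  using upward_pos[of n] by (subst F_coeff.simps) (simp add: sum_distrib_left)

lemma F_sum_ge_1: "1 \<le> i \<Longrightarrow> 1 \<le> (\<Sum>j=0..<i. F_coeff P j 0)"
  using member_le_sum[of 0 "{0..<i}" "\<lambda>j. F_coeff P j 0"] F_nonneg by auto

lemma green_coeff_0 [simp]: "green_coeff P g 0 = 0"
  by (simp add: green_coeff_def)

lemma green_coeff_nonneg: "(\<And>k. 1 \<le> k \<Longrightarrow> 0 \<le> g k) \<Longrightarrow> 0 \<le> green_coeff P g j"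
  unfolding green_coeff_def
  by (intro sum_nonneg divide_nonneg_nonneg mult_nonneg_nonneg F_nonneg) auto

text \<open>Each column \<open>k < n\<close> of \<open>F_coeff\<close> satisfies the homogeneous
  recursion at \<open>n\<close>; the diagonal term \<open>k = n\<close> contributes exactly
  \<open>g n\<close>.\<close>

lemma green_coeff_rec:
  assumes "1 \<le> n"
  shows "P n (Suc n) * green_coeff P g n = (\<Sum>j<n. row_sum P n j * green_coeff P g j) + g n"
proof -
  have *: "P n (Suc n) * (F_coeff P n k * g k / P k (Suc k))
      = (\<Sum>j\<in>{k..<n}. row_sum P n j * (F_coeff P j k * g k / P k (Suc k)))" if "k < n" for k
    using F_coeff_rec[OF that]
    by (simp add: sum_divide_distrib sum_distrib_right flip: mult.assoc)
  obtain m where n: "n = Suc m" using assms by (cases n) auto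
  have "P n (Suc n) * green_coeff P g n
      = (\<Sum>k=1..m. P n (Suc n) * (F_coeff P n k * g k / P k (Suc k))) + g n"
    using upward_pos[of n] by (simp add: green_coeff_def n sum_distrib_left distrib_left)
  also have "(\<Sum>k=1..m. P n (Suc n) * (F_coeff P n k * g k / P k (Suc k)))
      = (\<Sum>k=1..m. \<Sum>j\<in>{k..m}. row_sum P n j * (F_coeff P j k * g k / P k (Suc k)))"
    using * by (intro sum.cong) (auto simp: n atLeastLessThanSuc_atLeastAtMost)
  also have "\<dots> = (\<Sum>j=1..m. \<Sum>k=1..j. row_sum P n j * (F_coeff P j k * g k / P k (Suc k)))"
    by (rule sum_triangle_swap)
  also have "\<dots> = (\<Sum>j<n. row_sum P n j * green_coeff P g j)"
    by (simp add: green_coeff_def sum_distrib_left n lessThan_Suc_atMost atMost_atLeast0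
        sum.atLeast_Suc_atMost[of 0])
  finally show ?thesis .
qed

text \<open>Abel summation: row mass 1 leaves only differences, and the increment from
  \<open>j\<close> to \<open>Suc j\<close> occurs in \<open>x k - x i\<close> for every
  \<open>i \<le> j\<close>, which collects the weights into \<open>row_sum P k j\<close>.\<close>

lemma drift_eq:
  "(\<Sum>j\<le>Suc k. P k j * x j) - x k
    = P k (Suc k) * (x (Suc k) - x k) - (\<Sum>j<k. row_sum P k j * (x (Suc j) - x j))"
proof -
  have "(\<Sum>j\<le>Suc k. P k j * x j) - x k = (\<Sum>j\<le>Suc k. P k j * (x j - x k))"
    using row_sum_1[of k]
    by (simp add: right_diff_distrib sum_subtractf flip: sum_distrib_right distrib_right)
  also have "\<dots> = P k (Suc k) * (x (Suc k) - x k) - (\<Sum>j<k. P k j * (x k - x j))"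
    by (simp add: right_diff_distrib sum_subtractf flip: lessThan_Suc_atMost)
  also have "(\<Sum>j<k. P k j * (x k - x j)) = (\<Sum>j<k. row_sum P k j * (x (Suc j) - x j))"
  proof (cases k)
    case (Suc m)
    have "(\<Sum>j<k. P k j * (x k - x j)) = (\<Sum>j=0..m. \<Sum>i=j..m. P k j * (x (Suc i) - x i))"
      using Suc
      by (auto intro!: sum.cong simp: sum_Suc_diff lessThan_Suc_atMost atMost_atLeast0
          simp del: sum.lessThan_Suc simp flip: sum_distrib_left)
    also have "\<dots> = (\<Sum>i=0..m. \<Sum>j=0..i. P k j * (x (Suc i) - x i))"
      by (rule sum_triangle_swap)
    also have "\<dots> = (\<Sum>j<k. row_sum P k j * (x (Suc j) - x j))"
      using Suc by (simp add: row_sum_def sum_distrib_right lessThan_Suc_atMost atMost_atLeast0)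
    finally show ?thesis .
  qed simp
  finally show ?thesis .
qed

lemma profile_rec:
  assumes "1 \<le> k"
  shows "P k (Suc k) * (F_coeff P k 0 * c - green_coeff P g k)
    = (\<Sum>j<k. row_sum P k j * (F_coeff P j 0 * c - green_coeff P g j)) - g k"
proof -
  have "P k (Suc k) * (F_coeff P k 0 * c - green_coeff P g k)
      = (P k (Suc k) * F_coeff P k 0) * c - P k (Suc k) * green_coeff P g k"
    by (simp add: algebra_simps)
  then show ?thesis
    using F_coeff_rec[of 0 k] green_coeff_rec[OF assms, of g] assms
    by (simp add: atLeast0LessThan right_diff_distrib sum_subtractf sum_distrib_right mult.assoc)
qed

text \<open>The weights \<open>row_sum P k j\<close> on earlier increments are nonnegative, so an
  inequality between the two recursions propagates by induction. At \<open>k = 0\<close> both sides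
  equal \<open>x 1\<close>.\<close>

lemma subsolution_increment_ge:
  assumes "x 0 = 0"
    and sub: "\<And>k. 1 \<le> k \<Longrightarrow> k < n \<Longrightarrow> x k \<le> (\<Sum>j\<le>Suc k. P k j * x j) + g k"
    and "k < n"
  shows "F_coeff P k 0 * x 1 - green_coeff P g k \<le> x (Suc k) - x k"
  using \<open>k < n\<close>
proof (induction k rule: less_induct)
  case (less k)
  show ?case
  proof (cases "k = 0")
    case False
    then have k: "1 \<le> k" by simp
    have "P k (Suc k) * (F_coeff P k 0 * x 1 - green_coeff P g k)
        = (\<Sum>j<k. row_sum P k j * (F_coeff P j 0 * x 1 - green_coeff P g j)) - g k"
      by (rule profile_rec[OF k])
    also have "\<dots> \<le> (\<Sum>j<k. row_sum P k j * (x (Suc j) - x j)) - g k"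
      using less by (intro diff_right_mono sum_mono mult_left_mono row_sum_nonneg) auto
    also have "\<dots> \<le> P k (Suc k) * (x (Suc k) - x k)"
      using sub[OF k less.prems] drift_eq[of k x] by linarith
    finally show ?thesis
      using upward_pos[of k] by simp
  qed (use assms in simp)
qed

lemma subsolution_ge:
  assumes "x 0 = 0"
    and "\<And>k. 1 \<le> k \<Longrightarrow> k < n \<Longrightarrow> x k \<le> (\<Sum>j\<le>Suc k. P k j * x j) + g k"
  shows "(\<Sum>j=0..<n. F_coeff P j 0) * x 1 - (\<Sum>j=0..<n. green_coeff P g j) \<le> x n"
proof -
  have "(\<Sum>j=0..<n. F_coeff P j 0 * x 1 - green_coeff P g j) \<le> (\<Sum>j=0..<n. x (Suc j) - x j)"
    using subsolution_increment_ge[OF assms] by (intro sum_mono) auto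
  then show ?thesis
    by (simp only: sum_Suc_diff'[of 0 n x, simplified] sum_subtractf[of "\<lambda>j. F_coeff P j 0 * x 1"]
        sum_distrib_right assms(1) diff_zero)
qed

lemma green_coeff_minus: "green_coeff P (\<lambda>k. - g k) j = - green_coeff P g j"
  by (simp add: green_coeff_def sum_negf)

lemma supersolution_le:
  assumes "x 0 = 0"
    and "\<And>k. 1 \<le> k \<Longrightarrow> k < n \<Longrightarrow> (\<Sum>j\<le>Suc k. P k j * x j) + g k \<le> x k"
  shows "x n \<le> (\<Sum>j=0..<n. F_coeff P j 0) * x 1 - (\<Sum>j=0..<n. green_coeff P g j)"
proof -
  have "- x k \<le> (\<Sum>j\<le>Suc k. P k j * - x j) + - g k" if "1 \<le> k" "k < n" for k
    using assms(2)[OF that] by (simp add: sum_negf del: sum.atMost_Suc)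
  then show ?thesis
    using subsolution_ge[of "\<lambda>k. - x k" n "\<lambda>k. - g k"] assms(1)
    by (simp add: green_coeff_minus sum_negf)
qed

lemma profile_solution:
  assumes "1 \<le> k" and x: "\<And>i. x i = (\<Sum>j=0..<i. F_coeff P j 0 * c - green_coeff P g j)"
  shows "x k = (\<Sum>j\<le>Suc k. P k j * x j) + g k"
proof -
  have "x (Suc j) - x j = F_coeff P j 0 * c - green_coeff P g j" for j
    by (simp add: x)
  then show ?thesis
    using drift_eq[of k x] profile_rec[OF assms(1), of c g] by simp
qed

text \<open>The indicator of the nonzero states solves the equation with this source, so the two
  comparisons pin the difference of the partial sums to 1 for every \<open>n\<close>; subtracting
  consecutive values of \<open>n\<close> gives the identity.\<close>

lemma green_coeff_absorption:
  assumes "1 \<le> j"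
  shows "green_coeff P (\<lambda>k. P k 0) j = F_coeff P j 0"
proof -
  define x :: "nat \<Rightarrow> real" where "x = (\<lambda>k. if k = 0 then 0 else 1)"
  have "(\<Sum>j\<le>Suc k. P k j * x j) + P k 0 = x k" if "1 \<le> k" for k
    using row_sum_1[of k] that by (simp add: x_def sum.atMost_Suc_shift del: sum.atMost_Suc)
  then have *: "x k = (\<Sum>j\<le>Suc k. P k j * x j) + P k 0" if "1 \<le> k" for k
    using that by simp
  have "(\<Sum>j=0..<n. F_coeff P j 0) - (\<Sum>j=0..<n. green_coeff P (\<lambda>k. P k 0) j) = 1" if "1 \<le> n" for n
    using subsolution_ge[of x n "\<lambda>k. P k 0"] supersolution_le[of x n "\<lambda>k. P k 0"] * that
    by (force simp: x_def)
  from this[of j] this[of "Suc j"] show ?thesis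
    using assms by simp
qed

end

subsection \<open>Minimal solutions\<close>

text \<open>A Neumann series for the chain killed at 0: summed over \<open>n\<close>, the terms
  \<open>T n\<close> give the minimal nonnegative solution of \<open>x = Q x + g\<close> on the
  states from 1 on, with \<open>g\<close> the sum of the \<open>s n\<close>. A source depending on
  \<open>n\<close> allows moments of one order to feed those of the next.\<close>

locale killed_series = skip_free +
  fixes T s :: "nat \<Rightarrow> nat \<Rightarrow> real"
  assumes T_0: "\<And>i. T 0 i = s 0 i"
    and T_Suc: "\<And>n i. T (Suc n) i = (\<Sum>k\<in>{..Suc i} - {0}. P i k * T n k) + s (Suc n) i"
    and s_nonneg: "\<And>n i. 0 \<le> s n i"
begin

lemma T_nonneg: "0 \<le> T n i"
proof (induction n arbitrary: i)
  case 0
  then show ?case by (simp add: T_0 s_nonneg)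
next
  case (Suc n)
  then show ?case
    unfolding T_Suc by (intro add_nonneg_nonneg sum_nonneg mult_nonneg_nonneg s_nonneg) auto
qed

lemma partial_sum_Suc:
  "(\<Sum>n<Suc N. T n i) = (\<Sum>k\<in>{..Suc i} - {0}. P i k * (\<Sum>n<N. T n k)) + (\<Sum>n<Suc N. s n i)"
proof -
  have "(\<Sum>n<Suc N. T n i) = s 0 i + (\<Sum>n<N. T (Suc n) i)"
    by (subst sum.lessThan_Suc_shift) (simp add: T_0)
  also have "(\<Sum>n<N. T (Suc n) i) = (\<Sum>n<N. \<Sum>k\<in>{..Suc i} - {0}. P i k * T n k) + (\<Sum>n<N. s (Suc n) i)"
    by (simp add: T_Suc sum.distrib del: sum.atMost_Suc)
  also have "(\<Sum>n<N. \<Sum>k\<in>{..Suc i} - {0}. P i k * T n k) = (\<Sum>k\<in>{..Suc i} - {0}. P i k * (\<Sum>n<N. T n k))"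
    by (subst sum.swap) (simp add: sum_distrib_left)
  finally show ?thesis
    by (subst sum.lessThan_Suc_shift[of "\<lambda>n. s n i"]) simp
qed

text \<open>The step up from \<open>i\<close> has positive probability, so
  \<open>T n (Suc i)\<close> is at most a constant times \<open>T (Suc n) i\<close>.\<close>

lemma summable_upward:
  assumes "summable (\<lambda>n. T n i)"
  shows "summable (\<lambda>n. T n (Suc i))"
proof -
  have "T n (Suc i) \<le> T (Suc n) i / P i (Suc i)" for n
  proof -
    have "P i (Suc i) * T n (Suc i) \<le> (\<Sum>k\<in>{..Suc i} - {0}. P i k * T n k)"
      by (rule member_le_sum[of "Suc i" _ "\<lambda>k. P i k * T n k"]) (auto intro: mult_nonneg_nonneg T_nonneg)
    then have "P i (Suc i) * T n (Suc i) \<le> T (Suc n) i"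
      using T_Suc[of n i] s_nonneg[of "Suc n" i] by linarith
    then show ?thesis
      using upward_pos[of i] by (simp add: field_simps)
  qed
  moreover have "summable (\<lambda>n. T (Suc n) i / P i (Suc i))"
    using assms summable_Suc_iff[of "\<lambda>n. T n i"] by (intro summable_divide) blast
  ultimately show ?thesis
    by (subst (asm) abs_of_nonneg[OF T_nonneg, symmetric])
       (rule summable_comparison_test'[of "\<lambda>n. T (Suc n) i / P i (Suc i)" 0], auto)
qed

lemma summable_upward_le:
  assumes "summable (\<lambda>n. T n i)" "i \<le> k"
  shows "summable (\<lambda>n. T n k)"
  using assms(2,1) by (induction k rule: dec_induct) (auto intro: summable_upward)

lemma suminf_rec:
  assumes "\<And>k. k \<in> {..Suc i} - {0} \<Longrightarrow> summable (\<lambda>n. T n k)"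
    and "summable (\<lambda>n. s n i)"
  shows "(\<lambda>n. T n i) sums ((\<Sum>k\<in>{..Suc i} - {0}. P i k * (\<Sum>n. T n k)) + (\<Sum>n. s n i))"
proof -
  have "(\<lambda>n. s (Suc n) i) sums ((\<Sum>n. s n i) - s 0 i)"
    using assms(2) by (subst sums_Suc_iff) (simp add: summable_sums)
  moreover have "(\<lambda>n. \<Sum>k\<in>{..Suc i} - {0}. P i k * T n k) sums (\<Sum>k\<in>{..Suc i} - {0}. P i k * (\<Sum>n. T n k))"
    by (intro sums_sum sums_mult summable_sums assms(1))
  ultimately have "(\<lambda>n. T (Suc n) i) sums
      ((\<Sum>k\<in>{..Suc i} - {0}. P i k * (\<Sum>n. T n k)) + ((\<Sum>n. s n i) - s 0 i))"
    unfolding T_Suc by (rule sums_add[rotated])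
  from sums_Suc[OF this] show ?thesis
    by (simp add: T_0 algebra_simps del: sum.atMost_Suc)
qed

lemma suminf_rec_0:
  assumes "summable (\<lambda>n. T n 1)" "summable (\<lambda>n. s n 0)"
  shows "(\<lambda>n. T n 0) sums (P 0 1 * (\<Sum>n. T n 1) + (\<Sum>n. s n 0))"
proof -
  have "{..Suc 0} - {0} = {1}" by auto
  then show ?thesis
    using suminf_rec[of 0] assms by simp
qed

context
  fixes g :: "nat \<Rightarrow> real"
  assumes s_sums: "\<And>i. 1 \<le> i \<Longrightarrow> (\<lambda>n. s n i) sums g i"
begin

lemma partial_s_le: "1 \<le> i \<Longrightarrow> (\<Sum>n<N. s n i) \<le> g i"
  using s_sums[of i] sum_le_suminf[of "\<lambda>n. s n i" "{..<N}"] s_nonneg by (auto simp: sums_iff)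

text \<open>Partial sums arise by iterating a monotone affine map from zero, so they never pass a
  nonnegative supersolution. This is the minimality of the series.\<close>

lemma partial_sum_le_supersolution:
  assumes nonneg: "\<And>i. 1 \<le> i \<Longrightarrow> 0 \<le> x i"
    and super: "\<And>i. 1 \<le> i \<Longrightarrow> (\<Sum>k\<in>{..Suc i} - {0}. P i k * x k) + g i \<le> x i"
    and "1 \<le> i"
  shows "(\<Sum>n<N. T n i) \<le> x i"
  using \<open>1 \<le> i\<close>
proof (induction N arbitrary: i)
  case (Suc N)
  have "(\<Sum>n<Suc N. T n i) \<le> (\<Sum>k\<in>{..Suc i} - {0}. P i k * x k) + g i"
    unfolding partial_sum_Suc
    using Suc.prems by (intro add_mono sum_mono mult_left_mono Suc.IH partial_s_le) auto
  also have "\<dots> \<le> x i"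
    by (rule super[OF Suc.prems])
  finally show ?case .
qed (use nonneg in simp)

lemma summable_supersolution:
  assumes "\<And>i. 1 \<le> i \<Longrightarrow> 0 \<le> x i"
    and "\<And>i. 1 \<le> i \<Longrightarrow> (\<Sum>k\<in>{..Suc i} - {0}. P i k * x k) + g i \<le> x i"
    and "1 \<le> i"
  shows "summable (\<lambda>n. T n i)" "(\<Sum>n. T n i) \<le> x i"
proof -
  show "summable (\<lambda>n. T n i)"
    using partial_sum_le_supersolution[OF assms] T_nonneg
    by (intro summableI_nonneg_bounded[of _ "x i"]) auto
  then show "(\<Sum>n. T n i) \<le> x i"
    using partial_sum_le_supersolution[OF assms] by (intro suminf_le_const) auto
qed

text \<open>Truncated sums are subsolutions, hence their value at \<open>i\<close> grows with their
  value at 1, with a slope of at least 1 by \<open>F_sum_ge_1\<close>. A bound at \<open>i\<close>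
  thus yields one at 1.\<close>

lemma summable_downward:
  assumes "1 \<le> i" "summable (\<lambda>n. T n i)"
  shows "summable (\<lambda>n. T n 1)"
proof (rule summableI_nonneg_bounded)
  fix N
  \<comment> \<open>The comparison lemmas want the value 0 at state 0, where the chain is killed,
    whereas \<open>T n 0\<close> itself describes an excursion that starts from 0.\<close>
  let ?a = "\<lambda>N k. if k = 0 then 0 else \<Sum>n<N. T n k"
  have a: "(\<Sum>j\<le>Suc k. P k j * ?a N j) = (\<Sum>j\<in>{..Suc k} - {0}. P k j * (\<Sum>n<N. T n j))" for k
    by (rule sum.mono_neutral_cong_right) auto
  have "?a N k \<le> (\<Sum>j\<le>Suc k. P k j * ?a N j) + g k" if "1 \<le> k" for k
  proof -
    \<comment> \<open>Adding one nonnegative term allows \<open>partial_sum_Suc\<close> to be used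
      while keeping the same \<open>N\<close> on both sides.\<close>
    have "?a N k \<le> (\<Sum>n<Suc N. T n k)"
      using that T_nonneg by simp
    also have "\<dots> \<le> (\<Sum>j\<le>Suc k. P k j * ?a N j) + g k"
      unfolding a partial_sum_Suc using partial_s_le[OF that, of "Suc N"] by simp
    finally show ?thesis .
  qed
  from subsolution_ge[of "?a N" i g, OF _ this]
  have "(\<Sum>j=0..<i. F_coeff P j 0) * (\<Sum>n<N. T n 1) - (\<Sum>j=0..<i. green_coeff P g j) \<le> (\<Sum>n<N. T n i)"
    using assms(1) by simp
  moreover have "(\<Sum>n<N. T n 1) \<le> (\<Sum>j=0..<i. F_coeff P j 0) * (\<Sum>n<N. T n 1)"
    using mult_right_mono[OF F_sum_ge_1[OF assms(1)], of "\<Sum>n<N. T n 1"] T_nonneg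
    by (simp add: sum_nonneg)
  moreover have "(\<Sum>n<N. T n i) \<le> (\<Sum>n. T n i)"
    using assms(2) T_nonneg by (intro sum_le_suminf) auto
  ultimately show "(\<Sum>n<N. T n 1) \<le> (\<Sum>n. T n i) + (\<Sum>j=0..<i. green_coeff P g j)"
    by linarith
qed (rule T_nonneg)

lemma summable_all:
  assumes "1 \<le> i" "summable (\<lambda>n. T n i)" "1 \<le> k"
  shows "summable (\<lambda>n. T n k)"
  using summable_upward_le[OF summable_downward[OF assms(1,2)] assms(3)] .

text \<open>A number \<open>c\<close> above all ratios makes the explicit profile with value
  \<open>c\<close> at state 1 a nonnegative solution, which dominates the series by
  minimality.\<close>

lemma summable_of_ratio_bound:
  assumes bound: "\<And>i. 1 \<le> i \<Longrightarrow>
      (\<Sum>j=0..<i. green_coeff P g j) / (\<Sum>j=0..<i. F_coeff P j 0) \<le> c"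
    and "1 \<le> i"
  shows "summable (\<lambda>n. T n i)" "(\<Sum>n. T n i) \<le> (\<Sum>j=0..<i. F_coeff P j 0 * c - green_coeff P g j)"
proof -
  define x where "x = (\<lambda>i. \<Sum>j=0..<i. F_coeff P j 0 * c - green_coeff P g j)"
  have "0 \<le> x i" if "1 \<le> i" for i
  proof -
    have "0 < (\<Sum>j=0..<i. F_coeff P j 0)"
      using F_sum_ge_1[OF that] by linarith
    then have "(\<Sum>j=0..<i. green_coeff P g j) \<le> (\<Sum>j=0..<i. F_coeff P j 0) * c"
      using bound[OF that] by (simp add: divide_le_eq mult.commute)
    then show ?thesis
      by (simp add: x_def sum_subtractf sum_distrib_right)
  qed
  moreover have "(\<Sum>k\<in>{..Suc i} - {0}. P i k * x k) + g i \<le> x i" if "1 \<le> i" for i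
  proof -
    have "(\<Sum>k\<in>{..Suc i} - {0}. P i k * x k) = (\<Sum>k\<le>Suc i. P i k * x k)"
      by (intro sum.mono_neutral_left) (auto simp: x_def)
    then show ?thesis
      using profile_solution[OF that, of x c g] x_def by simp
  qed
  ultimately show "summable (\<lambda>n. T n i)" "(\<Sum>n. T n i) \<le> x i"
    using summable_supersolution[of x i] \<open>1 \<le> i\<close> by blast+
qed

context
  assumes summable_T: "\<And>i. 1 \<le> i \<Longrightarrow> summable (\<lambda>n. T n i)"
begin

text \<open>The sum, set to 0 at state 0, is both a subsolution and a supersolution, so the two
  comparison bounds coincide.\<close>

lemma suminf_profile:
  assumes "1 \<le> i"
  shows "(\<Sum>n. T n i) = (\<Sum>j=0..<i. F_coeff P j 0) * (\<Sum>n. T n 1) - (\<Sum>j=0..<i. green_coeff P g j)"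
proof -
  let ?x = "\<lambda>k. if k = 0 then 0 else \<Sum>n. T n k"
  have eq: "?x k = (\<Sum>j\<le>Suc k. P k j * ?x j) + g k" if "1 \<le> k" for k
  proof -
    have "(\<Sum>j\<le>Suc k. P k j * ?x j) = (\<Sum>j\<in>{..Suc k} - {0}. P k j * (\<Sum>n. T n j))"
      by (rule sum.mono_neutral_cong_right) auto
    moreover have "(\<lambda>n. T n k) sums ((\<Sum>j\<in>{..Suc k} - {0}. P k j * (\<Sum>n. T n j)) + (\<Sum>n. s n k))"
      using s_sums[OF that] by (intro suminf_rec summable_T) (auto simp: sums_iff)
    ultimately show ?thesis
      using that s_sums[OF that] by (auto simp: sums_iff)
  qed
  have "?x i = (\<Sum>j=0..<i. F_coeff P j 0) * ?x 1 - (\<Sum>j=0..<i. green_coeff P g j)"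
    by (intro antisym subsolution_ge supersolution_le eq_refl[OF eq] eq_refl[OF eq[symmetric]]) simp_all
  then show ?thesis
    using assms by simp
qed

lemma ratio_le_suminf:
  assumes "1 \<le> i"
  shows "(\<Sum>j=0..<i. green_coeff P g j) / (\<Sum>j=0..<i. F_coeff P j 0) \<le> (\<Sum>n. T n 1)"
proof -
  have "0 \<le> (\<Sum>n. T n i)"
    using summable_T[OF assms] T_nonneg by (intro suminf_nonneg) auto
  then show ?thesis
    using suminf_profile[OF assms] F_sum_ge_1[OF assms] by (simp add: divide_le_eq mult.commute)
qed

text \<open>Nonnegativity of the solution at every \<open>i\<close> puts its value at 1 above all
  ratios; minimality puts it below every real upper bound of them.\<close>

lemma suminf_eq_SUP:
  "ereal (\<Sum>n. T n 1)
    = (SUP i\<in>{1..}. ereal ((\<Sum>j=0..<i. green_coeff P g j) / (\<Sum>j=0..<i. F_coeff P j 0)))"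
    (is "_ = (SUP i\<in>{1..}. ereal (?r i))" is "_ = ?S")
proof (rule antisym)
  show "?S \<le> ereal (\<Sum>n. T n 1)"
    using ratio_le_suminf by (intro SUP_least) auto
  show "ereal (\<Sum>n. T n 1) \<le> ?S"
  proof (cases ?S)
    case (real c)
    have "?r i \<le> c" if "1 \<le> i" for i
      using SUP_upper[of i "{1..}" "\<lambda>i. ereal (?r i)"] that unfolding real by simp
    \<comment> \<open>At state 1 the profile reduces to \<open>c\<close>, because
      \<open>F_coeff P 0 0 = 1\<close> and \<open>green_coeff P g 0 = 0\<close>.\<close>
    from summable_of_ratio_bound(2)[OF this, of 1] show ?thesis
      unfolding real by simp
  next
    case MInf
    then show ?thesis
      using SUP_upper[of 1 "{1..}" "\<lambda>i. ereal (?r i)"] by simp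
  qed simp
qed

end

lemma summable_iff_SUP_finite:
  "(\<forall>i\<ge>1. summable (\<lambda>n. T n i)) \<longleftrightarrow>
    (SUP i\<in>{1..}. ereal ((\<Sum>j=0..<i. green_coeff P g j) / (\<Sum>j=0..<i. F_coeff P j 0))) \<noteq> \<infinity>"
    (is "_ \<longleftrightarrow> ?S \<noteq> \<infinity>")
proof
  assume "\<forall>i\<ge>1. summable (\<lambda>n. T n i)"
  then show "?S \<noteq> \<infinity>"
    using suminf_eq_SUP by (metis PInfty_neq_ereal(1))
next
  assume "?S \<noteq> \<infinity>"
  then obtain c where c: "?S \<le> ereal c"
    by (cases ?S) auto
  then have "(\<Sum>j=0..<i. green_coeff P g j) / (\<Sum>j=0..<i. F_coeff P j 0) \<le> c" if "1 \<le> i" for i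
    using that by (auto simp: SUP_le_iff)
  then show "\<forall>i\<ge>1. summable (\<lambda>n. T n i)"
    using summable_of_ratio_bound(1) by blast
qed

end
end

subsection \<open>Renewal sequences\<close>

text \<open>The indices are offset: \<open>f n\<close> belongs to a first return at time
  \<open>n + 1\<close>, while \<open>U n\<close> belongs to time \<open>n\<close>.\<close>

locale renewal =
  fixes f U :: "nat \<Rightarrow> real"
  assumes f_nonneg: "\<And>n. 0 \<le> f n"
    and U_nonneg: "\<And>n. 0 \<le> U n"
    and U_0: "U 0 = 1"
    and U_Suc: "\<And>n. U (Suc n) = (\<Sum>k\<le>n. f k * U (n - k))"
begin

lemma f_le_U: "f n \<le> U (Suc n)"
proof -
  have "f n * U (n - n) \<le> (\<Sum>k\<le>n. f k * U (n - k))"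
    by (rule member_le_sum[of n _ "\<lambda>k. f k * U (n - k)"]) (auto intro: mult_nonneg_nonneg f_nonneg U_nonneg)
  then show ?thesis
    by (simp add: U_0 U_Suc)
qed

text \<open>Summing the renewal equation gives \<open>suminf f * suminf U = suminf U - 1\<close>
  with a finite positive \<open>suminf U\<close>.\<close>

lemma suminf_f_less_1:
  assumes "summable U"
  shows "summable f" "suminf f < 1"
proof -
  have U_shift: "summable (\<lambda>n. U (Suc n))"
    using assms by (simp add: summable_Suc_iff)
  show f: "summable f"
    by (rule summable_comparison_test'[OF U_shift, of 0]) (use f_le_U f_nonneg in auto)
  have "suminf f * suminf U = (\<Sum>n. U (Suc n))"
    unfolding U_Suc using f assms f_nonneg U_nonneg by (intro Cauchy_product) auto
  then have "suminf f * suminf U = suminf U - 1"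
    using suminf_split_head[OF assms] by (simp add: U_0)
  moreover have "1 \<le> suminf U"
    using sum_le_suminf[OF assms, of "{0}"] U_nonneg by (simp add: U_0)
  ultimately have "suminf f * suminf U < 1 * suminf U" "0 < suminf U"
    by auto
  then show "suminf f < 1"
    by (simp only: mult_less_cancel_right_pos)
qed

text \<open>Each partial sum of \<open>b\<close> is bounded by an affine function of the preceding
  one, with slope \<open>suminf f < 1\<close>, so the partial sums stay below its fixed
  point.\<close>

lemma summable_defective:
  assumes f: "summable f" "suminf f < 1"
    and b_nonneg: "\<And>n. 0 \<le> b n"
    and s: "summable s" and s_nonneg: "\<And>n. 0 \<le> s n"
    and b_Suc: "\<And>n. b (Suc n) \<le> s n + (\<Sum>k\<le>n. f k * b (n - k))"
  shows "summable b"
proof (rule summableI_nonneg_bounded)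
  \<comment> \<open>The fixed point of \<open>B = b 0 + suminf s + suminf f * B\<close>.\<close>
  let ?B = "(b 0 + suminf s) / (1 - suminf f)"
  have f0: "0 \<le> suminf f"
    by (intro suminf_nonneg f f_nonneg)
  have s0: "0 \<le> suminf s"
    by (intro suminf_nonneg s s_nonneg)
  show "(\<Sum>n<N. b n) \<le> ?B" for N
  proof (induction N)
    case 0
    then show ?case
      using f b_nonneg[of 0] s0 by simp
  next
    case (Suc N)
    have "(\<Sum>n<N. \<Sum>k\<le>n. f k * b (n - k)) = (\<Sum>(i, j) | i + j < N. f i * b j)"
      by (rule sum.triangle_reindex[symmetric])
    also have "\<dots> \<le> (\<Sum>(i, j)\<in>{..<N} \<times> {..<N}. f i * b j)"
      by (intro sum_mono2) (auto intro: mult_nonneg_nonneg f_nonneg b_nonneg)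
    also have "\<dots> = (\<Sum>n<N. f n) * (\<Sum>n<N. b n)"
      by (simp add: sum_product sum.cartesian_product)
    also have "\<dots> \<le> suminf f * ?B"
      using Suc.IH f_nonneg b_nonneg f f0 by (intro mult_mono sum_le_suminf) (auto intro: sum_nonneg)
    finally have "(\<Sum>n<N. \<Sum>k\<le>n. f k * b (n - k)) \<le> suminf f * ?B" .
    moreover have "(\<Sum>n<N. b (Suc n)) \<le> (\<Sum>n<N. s n + (\<Sum>k\<le>n. f k * b (n - k)))"
      by (intro sum_mono b_Suc)
    moreover have "(\<Sum>n<N. s n) \<le> suminf s"
      using s s_nonneg by (intro sum_le_suminf) auto
    moreover have "?B = b 0 + suminf s + suminf f * ?B"
      using f(2) by (simp add: field_simps)
    ultimately show ?case
      unfolding sum.lessThan_Suc_shift[of b] sum.distrib by linarith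
  qed
qed (rule b_nonneg)

text \<open>In the renewal equation \<open>n + 1\<close> is split as
  \<open>(n - k) + (k + 1)\<close> and its power expanded. The top term in \<open>n - k\<close> is a
  defective convolution of the sequence with \<open>f\<close>; all others are Cauchy products with
  lower powers, summable by induction.\<close>

lemma summable_power_U:
  assumes f: "suminf f < 1" and "summable (\<lambda>n. real (Suc n) ^ l * f n)"
  shows "summable (\<lambda>n. real n ^ l * U n)"
  using assms(2)
proof (induction l rule: less_induct)
  case (less l)
  have c: "summable (\<lambda>n. real (Suc n) ^ j * f n)" if "j \<le> l" for j
    by (rule summable_comparison_test'[OF less.prems, of 0])
       (use that f_nonneg in \<open>auto intro!: mult_right_mono power_increasing\<close>)
  have b: "summable (\<lambda>n. real n ^ j * U n)" if "j < l" for j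
    using that by (intro less.IH c) auto
  define s where "s = (\<lambda>n. \<Sum>j<l. real (l choose j) *
      (\<Sum>k\<le>n. (real (Suc k) ^ (l - j) * f k) * (real (n - k) ^ j * U (n - k))))"
  have "real (Suc n) ^ l * U (Suc n) = s n + (\<Sum>k\<le>n. f k * (real (n - k) ^ l * U (n - k)))" for n
  proof -
    have *: "real (Suc n) ^ l = (\<Sum>j\<le>l. real (l choose j) * real (n - k) ^ j * real (Suc k) ^ (l - j))"
      if "k \<le> n" for k
    proof -
      have "real (Suc n) = real (n - k) + real (Suc k)"
        using that by simp
      then show ?thesis
        by (simp only: binomial_ring)
    qed
    have "real (Suc n) ^ l * U (Suc n) = (\<Sum>k\<le>n. \<Sum>j\<le>l. real (l choose j) *
        ((real (Suc k) ^ (l - j) * f k) * (real (n - k) ^ j * U (n - k))))"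
      unfolding U_Suc sum_distrib_left
      by (intro sum.cong refl, subst *)
         (auto simp only: atMost_iff sum_distrib_left mult_ac intro!: sum.cong)
    also have "\<dots> = (\<Sum>j\<le>l. real (l choose j) *
      (\<Sum>k\<le>n. (real (Suc k) ^ (l - j) * f k) * (real (n - k) ^ j * U (n - k))))"
      by (subst sum.swap) (simp add: sum_distrib_left)
    finally show ?thesis
      by (simp add: s_def flip: lessThan_Suc_atMost[of l])
  qed
  moreover have "summable s"
    unfolding s_def
    using b c f_nonneg U_nonneg
    by (intro summable_sum summable_mult summable_Cauchy_product) (auto simp: abs_mult)
  moreover have "summable f"
    using c[of 0] by simp
  ultimately show ?case
    using f_nonneg U_nonneg f
    by - (rule summable_defective[where s = s], auto simp: s_def intro!: sum_nonneg mult_nonneg_nonneg)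
qed

lemma summable_power_U_iff:
  assumes "1 \<le> l"
  shows "summable (\<lambda>n. real n ^ l * U n) \<longleftrightarrow> summable (\<lambda>n. real (Suc n) ^ l * f n) \<and> suminf f < 1"
proof
  assume U: "summable (\<lambda>n. real n ^ l * U n)"
  then have U': "summable (\<lambda>n. real (Suc n) ^ l * U (Suc n))"
    by (subst (asm) summable_Suc_iff[symmetric])
  have "summable U"
  \<comment> \<open>The comparison starts at 1 because the weight \<open>real n ^ l\<close> vanishes
    at \<open>n = 0\<close>.\<close>
  proof (rule summable_comparison_test'[OF U, of 1])
    fix n :: nat assume "1 \<le> n"
    then have "1 \<le> real n ^ l"
      by (simp add: one_le_power)
    from mult_right_mono[OF this U_nonneg, of n] show "norm (U n) \<le> real n ^ l * U n"
      using U_nonneg[of n] by simp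
  qed
  then have "suminf f < 1"
    by (rule suminf_f_less_1)
  moreover have "summable (\<lambda>n. real (Suc n) ^ l * f n)"
    by (rule summable_comparison_test'[OF U', of 0])
       (use f_nonneg f_le_U in \<open>auto simp: abs_mult intro!: mult_left_mono\<close>)
  ultimately show "summable (\<lambda>n. real (Suc n) ^ l * f n) \<and> suminf f < 1" by blast
qed (use summable_power_U in blast)

end

section \<open>First-passage decomposition and solidarity of the states\<close>

context skip_free
begin

lemma first_passage_nonneg [simp]: "0 \<le> first_passage P y n i"
  by (induction n arbitrary: i) (auto intro!: sum_nonneg mult_nonneg_nonneg simp del: sum.atMost_Suc)

text \<open>This holds for every \<open>y\<close>: a target out of reach of one step has
  \<open>P i y = 0\<close>.\<close>

lemma row_split: "(\<Sum>k\<le>Suc i. P i k * h k) = P i y * h y + (\<Sum>k\<in>{..Suc i} - {y}. P i k * h k)"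
proof (cases "y \<le> Suc i")
  case False
  then have "P i y = 0" "{..Suc i} - {y} = {..Suc i}"
    using skip_free[of i y] by auto
  then show ?thesis by simp
qed (simp add: sum.remove del: sum.atMost_Suc)

text \<open>Paths are split at their first visit to \<open>y\<close>. The start stays arbitrary in
  the induction since a first step that misses \<open>y\<close> leads to a new start; with start
  \<open>y\<close> the identity becomes a renewal equation.\<close>

lemma mat_power_renewal:
  "mat_power P (Suc n) i y = (\<Sum>k\<le>n. first_passage P y k i * mat_power P (n - k) y y)"
proof (induction n arbitrary: i)
  case 0
  have "mat_power P (Suc 0) i y = P i y * mat_power P 0 y y"
    unfolding mat_power_Suc row_split[where y = y] by simp
  then show ?case by simp
next
  case (Suc n)
  have "(\<Sum>j\<in>{..Suc i} - {y}. P i j * mat_power P (Suc n) j y)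
      = (\<Sum>j\<in>{..Suc i} - {y}. \<Sum>k\<le>n. P i j * first_passage P y k j * mat_power P (n - k) y y)"
    unfolding Suc.IH by (simp add: sum_distrib_left mult.assoc del: sum.atMost_Suc)
  also have "\<dots> = (\<Sum>k\<le>n. first_passage P y (Suc k) i * mat_power P (n - k) y y)"
    by (subst sum.swap) (simp add: sum_distrib_right del: sum.atMost_Suc)
  finally show ?case
    unfolding mat_power_Suc[of "Suc n"] row_split[where y = y] sum.atMost_Suc_shift by simp
qed

sublocale renewal "\<lambda>n. first_passage P y n y" "\<lambda>n. mat_power P n y y" for y
  by unfold_locales (auto simp: mat_power_renewal simp del: mat_power.simps(2))

text \<open>A loop at \<open>y\<close> inserted between fixed routes from \<open>x\<close> to
  \<open>y\<close> and back is a loop at \<open>x\<close>. This bounds returns to \<open>y\<close>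
  by later returns to \<open>x\<close>, up to a positive constant, and the weight only grows with
  time.\<close>

lemma summable_mat_power_transfer:
  assumes "summable (\<lambda>n. real n ^ l * mat_power P n x x)"
  shows "summable (\<lambda>n. real n ^ l * mat_power P n y y)"
proof -
  obtain a where a: "0 < mat_power P a x y"
    using irreducible by (auto simp: irreducible_matrix_def)
  obtain b where b: "0 < mat_power P b y x"
    using irreducible by (auto simp: irreducible_matrix_def)
  let ?c = "mat_power P a x y * mat_power P b y x"
  have "summable (\<lambda>n. real (n + (a + b)) ^ l * mat_power P (n + (a + b)) x x)"
    using assms by (subst summable_iff_shift)
  then have *: "summable (\<lambda>n. (real (n + (a + b)) ^ l * mat_power P (n + (a + b)) x x) / ?c)"
    by (rule summable_divide)
  show ?thesis
  proof (rule summable_comparison_test'[OF *, of 0])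
    fix n
    have "?c * mat_power P n y y = mat_power P a x y * mat_power P n y y * mat_power P b y x"
      by simp
    also have "\<dots> \<le> mat_power P (a + n) x y * mat_power P b y x"
      by (intro mult_right_mono mat_power_add_ge) simp
    also have "\<dots> \<le> mat_power P (a + n + b) x x"
      by (rule mat_power_add_ge)
    finally have "?c * mat_power P n y y \<le> mat_power P (n + (a + b)) x x"
      by (simp add: add_ac)
    then have "real n ^ l * (?c * mat_power P n y y)
        \<le> real (n + (a + b)) ^ l * mat_power P (n + (a + b)) x x"
      by (intro mult_mono power_mono) auto
    then show "norm (real n ^ l * mat_power P n y y)
        \<le> (real (n + (a + b)) ^ l * mat_power P (n + (a + b)) x x) / ?c"
      using a b by (simp add: pos_le_divide_eq mult_ac)
  qed
qed

end

subsection \<open>The law of the path\<close>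

text \<open>Building the law of the path from its first step gives events a first-step recursion,
  whereas \<open>markov_chain\<close> prescribes the last step. Both lead to the same product over a
  cylinder.\<close>

primrec path_pmf :: "(nat \<Rightarrow> nat pmf) \<Rightarrow> nat \<Rightarrow> nat \<Rightarrow> nat list pmf" where
  "path_pmf K 0 i = return_pmf [i]"
| "path_pmf K (Suc n) i = bind_pmf (K i) (\<lambda>j. map_pmf (Cons i) (path_pmf K n j))"

lemma path_pmf_support:
  "xs \<in> set_pmf (path_pmf K n i) \<Longrightarrow> length xs = Suc n \<and> xs ! 0 = i"
  by (induction n arbitrary: i xs) auto

lemma pmf_path_pmf:
  "pmf (path_pmf K n i) (map x [0..<Suc n])
    = (if x 0 = i then \<Prod>k<n. pmf (K (x k)) (x (Suc k)) else 0)"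
proof (induction n arbitrary: i x)
  case 0
  then show ?case by (auto simp: pmf_return)
next
  case (Suc n)
  have x: "map x [0..<Suc (Suc n)] = x 0 # map (x \<circ> Suc) [0..<Suc n]"
    by (simp del: upt_Suc add: upt_conv_Cons[of 0 "Suc (Suc n)"] map_Suc_upt[symmetric])
  show ?case
  proof (cases "x 0 = i")
    case True
    then have "pmf (path_pmf K (Suc n) i) (map x [0..<Suc (Suc n)])
        = (\<integral>j. pmf (path_pmf K n j) (map (x \<circ> Suc) [0..<Suc n]) \<partial>measure_pmf (K i))"
      unfolding x by (simp add: pmf_bind pmf_map_inj' del: upt_Suc)
    also have "\<dots> = (\<integral>j. (if x (Suc 0) = j then \<Prod>k<n. pmf (K (x (Suc k))) (x (Suc (Suc k))) else 0) \<partial>measure_pmf (K i))"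
      unfolding Suc.IH o_def ..
    also have "\<dots> = pmf (K i) (x (Suc 0)) * (\<Prod>k<n. pmf (K (x (Suc k))) (x (Suc (Suc k))))"
      by (subst integral_measure_pmf[of "{x (Suc 0)}"]) (auto split: if_splits)
    also have "\<dots> = (\<Prod>k<Suc n. pmf (K (x k)) (x (Suc k)))"
      using True by (simp only: prod.lessThan_Suc_shift)
    finally show ?thesis
      using True by simp
  next
    case False
    then have "map x [0..<Suc (Suc n)] \<notin> set_pmf (path_pmf K (Suc n) i)"
      unfolding x by auto
    then show ?thesis
      using False by (simp only: set_pmf_iff not_not if_False)
  qed
qed

definition path_prob :: "(nat \<Rightarrow> nat pmf) \<Rightarrow> nat \<Rightarrow> nat \<Rightarrow> (nat list \<Rightarrow> bool) \<Rightarrow> real" where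
  "path_prob K n i Q = measure_pmf.prob (path_pmf K n i) {xs. Q xs}"

lemma path_prob_0: "path_prob K 0 i Q = (if Q [i] then 1 else 0)"
  by (simp add: path_prob_def measure_pmf_single indicator_def)

lemma path_prob_cong:
  "(\<And>xs. length xs = Suc n \<Longrightarrow> xs ! 0 = i \<Longrightarrow> Q xs = R xs) \<Longrightarrow> path_prob K n i Q = path_prob K n i R"
  unfolding path_prob_def by (rule measure_prob_cong_0) (use path_pmf_support in \<open>fastforce simp: set_pmf_iff\<close>)+

lemma path_prob_Suc:
  assumes "finite A" "set_pmf (K i) \<subseteq> A"
  shows "path_prob K (Suc n) i Q = (\<Sum>j\<in>A. pmf (K i) j * path_prob K n j (\<lambda>xs. Q (i # xs)))"
proof -
  have *: "path_prob K n i Q = pmf (map_pmf Q (path_pmf K n i)) True" for n i Q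
    by (simp add: path_prob_def pmf_map vimage_def)
  show ?thesis
    using assms unfolding *
    by (subst path_pmf.simps, unfold map_bind_pmf pmf_bind, subst integral_measure_pmf[of A])
       (auto simp: map_pmf_comp)
qed

text \<open>The infimum is replaced by a condition on finitely many coordinates, from which
  measurability and the probability follow.\<close>

lemma hit_time_eq_Suc_iff:
  "hit_time \<Phi> y \<omega> = enat (Suc n) \<longleftrightarrow> \<Phi> (Suc n) \<omega> = y \<and> (\<forall>k\<in>{1..n}. \<Phi> k \<omega> \<noteq> y)"
proof -
  let ?A = "{enat n | n. n \<ge> 1 \<and> \<Phi> n \<omega> = y}"
  have Inf_mem: "Inf ?A \<in> ?A" if "?A \<noteq> {}"
    using that unfolding Inf_enat_def by (metis (mono_tags, lifting) LeastI_ex ex_in_conv)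
  show ?thesis
  proof
    assume *: "hit_time \<Phi> y \<omega> = enat (Suc n)"
    then have Inf: "Inf ?A = enat (Suc n)"
      by (simp only: hit_time_def)
    have "?A \<noteq> {}"
    proof
      assume "?A = {}"
      with Inf have "Inf {} = enat (Suc n)" by (simp only:)
      then show False by (simp add: Inf_enat_def)
    qed
    with Inf_mem Inf have "\<Phi> (Suc n) \<omega> = y"
      by auto
    moreover have "\<Phi> k \<omega> \<noteq> y" if "k \<in> {1..n}" for k
    proof
      assume "\<Phi> k \<omega> = y"
      with that have "enat k \<in> ?A" by auto
      then have "Inf ?A \<le> enat k" by (rule Inf_lower)
      with Inf that show False by simp
    qed
    ultimately show "\<Phi> (Suc n) \<omega> = y \<and> (\<forall>k\<in>{1..n}. \<Phi> k \<omega> \<noteq> y)" by blast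
  next
    assume *: "\<Phi> (Suc n) \<omega> = y \<and> (\<forall>k\<in>{1..n}. \<Phi> k \<omega> \<noteq> y)"
    have "Inf ?A = enat (Suc n)"
    proof (rule antisym)
      show "Inf ?A \<le> enat (Suc n)"
        using * by (intro Inf_lower) auto
      show "enat (Suc n) \<le> Inf ?A"
      proof (rule Inf_greatest)
        fix e assume "e \<in> ?A"
        then obtain k where "e = enat k" "1 \<le> k" "\<Phi> k \<omega> = y" by auto
        with * show "enat (Suc n) \<le> e"
          by (cases "k \<le> n") auto
      qed
    qed
    then show "hit_time \<Phi> y \<omega> = enat (Suc n)"
      by (simp only: hit_time_def)
  qed
qed

lemma hit_time_finite_iff: "hit_time \<Phi> y \<omega> < \<infinity> \<longleftrightarrow> (\<exists>n. hit_time \<Phi> y \<omega> = enat (Suc n))"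
proof
  assume "hit_time \<Phi> y \<omega> < \<infinity>"
  then obtain m where m: "hit_time \<Phi> y \<omega> = enat m"
    by (cases "hit_time \<Phi> y \<omega>") auto
  have "1 \<le> hit_time \<Phi> y \<omega>"
    unfolding hit_time_def by (rule Inf_greatest) (auto simp: one_enat_def)
  with m show "\<exists>n. hit_time \<Phi> y \<omega> = enat (Suc n)"
    by (cases m) (auto simp: zero_enat_def[symmetric])
qed auto

section \<open>Finite-dimensional laws of the process\<close>

locale skip_free_process = skip_free +
  fixes M :: "nat \<Rightarrow> 'w measure" and \<Phi> :: "nat \<Rightarrow> 'w \<Rightarrow> nat"
  assumes markov: "markov_chain P M \<Phi>"
begin

lemma prob_space_M: "prob_space (M i)"
  using markov by (simp add: markov_chain_def)

lemma measurable_Phi [measurable]: "\<Phi> n \<in> measurable (M i) (count_space UNIV)"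
  using markov by (simp add: markov_chain_def)

lemma initial: "\<P>(\<omega> in M i. \<Phi> 0 \<omega> = i) = 1"
  using markov by (simp add: markov_chain_def)

lemma transition:
  "\<P>(\<omega> in M i. \<forall>k\<le>n. \<Phi> k \<omega> = x k) > 0 \<Longrightarrow>
    \<P>(\<omega> in M i. \<Phi> (Suc n) \<omega> = x (Suc n) \<bar> \<forall>k\<le>n. \<Phi> k \<omega> = x k) = P (x n) (x (Suc n))"
  using markov by (simp add: markov_chain_def)

lemma cylinder_prob:
  "\<P>(\<omega> in M i. \<forall>k\<le>n. \<Phi> k \<omega> = x k) = (if x 0 = i then \<Prod>k<n. P (x k) (x (Suc k)) else 0)"
proof (induction n)
  case 0
  interpret prob_space "M i" by (rule prob_space_M)
  have "AE \<omega> in M i. \<Phi> 0 \<omega> = i"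
    using initial[of i] by (subst (asm) prob_Collect_eq_1) auto
  then have "prob {\<omega> \<in> space (M i). \<Phi> 0 \<omega> = x 0} = 0" if "x 0 \<noteq> i"
    by (subst prob_Collect_eq_0) (use that in auto)
  then show ?case
    using initial[of i] by auto
next
  case (Suc n)
  interpret prob_space "M i" by (rule prob_space_M)
  have split: "{\<omega> \<in> space (M i). \<forall>k\<le>Suc n. \<Phi> k \<omega> = x k}
      = {\<omega> \<in> space (M i). \<Phi> (Suc n) \<omega> = x (Suc n) \<and> (\<forall>k\<le>n. \<Phi> k \<omega> = x k)}"
    by (auto simp: le_Suc_eq)
  show ?case
  \<comment> \<open>Conditional probabilities are prescribed only on cylinders of positive mass.
    Over a null cylinder the longer one is null too, and the formula already gives 0 by
    induction.\<close>
  proof (cases "prob {\<omega> \<in> space (M i). \<forall>k\<le>n. \<Phi> k \<omega> = x k} = 0")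
    case True
    have "prob {\<omega> \<in> space (M i). \<forall>k\<le>Suc n. \<Phi> k \<omega> = x k} \<le> prob {\<omega> \<in> space (M i). \<forall>k\<le>n. \<Phi> k \<omega> = x k}"
      by (intro finite_measure_mono) auto
    with True show ?thesis
      using Suc.IH by (auto simp: measure_le_0_iff split: if_splits)
  next
    case False
    then have "0 < prob {\<omega> \<in> space (M i). \<forall>k\<le>n. \<Phi> k \<omega> = x k}"
      by (simp add: zero_less_measure_iff)
    from transition[OF this] False show ?thesis
      unfolding split cond_prob_def using Suc.IH by (auto simp: field_simps split: if_splits)
  qed
qed

definition kernel :: "nat \<Rightarrow> nat pmf" where
  "kernel i = embed_pmf (P i)"

lemma pmf_kernel: "pmf (kernel i) j = P i j"
  unfolding kernel_def
proof (rule pmf_embed_pmf)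
  have "(\<lambda>j. P i j) sums 1"
    using stochastic by (simp add: stochastic_def)
  then show "(\<integral>\<^sup>+ j. ennreal (P i j) \<partial>count_space UNIV) = 1"
    by (simp add: nn_integral_count_space_nat suminf_ennreal2 sums_iff)
qed simp

lemma set_pmf_kernel: "set_pmf (kernel i) \<subseteq> {..Suc i}"
proof
  fix j assume "j \<in> set_pmf (kernel i)"
  then show "j \<in> {..Suc i}"
    using skip_free[of i j] by (cases "j \<le> Suc i") (auto simp: set_pmf_iff pmf_kernel)
qed

lemma map_upt_eq_iff: "map f [0..<n] = xs \<longleftrightarrow> length xs = n \<and> (\<forall>k<n. f k = xs ! k)"
proof
  assume "map f [0..<n] = xs"
  then show "length xs = n \<and> (\<forall>k<n. f k = xs ! k)" by auto
next
  assume "length xs = n \<and> (\<forall>k<n. f k = xs ! k)"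
  then show "map f [0..<n] = xs" by (intro nth_equalityI) auto
qed

lemma measurable_path [measurable]:
  "(\<lambda>\<omega>. map (\<lambda>k. \<Phi> k \<omega>) [0..<n]) \<in> measurable (M i) (count_space UNIV)"
proof -
  have "(\<lambda>\<omega>. map (\<lambda>k. \<Phi> k \<omega>) [0..<n]) -` {xs} \<inter> space (M i)
      = {\<omega> \<in> space (M i). length xs = n \<and> (\<forall>k<n. \<Phi> k \<omega> = xs ! k)}" for xs
    by (auto simp: map_upt_eq_iff)
  moreover have "{\<omega> \<in> space (M i). length xs = n \<and> (\<forall>k<n. \<Phi> k \<omega> = xs ! k)} \<in> sets (M i)" for xs
    by measurable
  ultimately show ?thesis
    by (simp add: measurable_count_space_eq2_countable)
qed

text \<open>Lists of naturals are countable, so agreement on singletons suffices; those of length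
  \<open>Suc n\<close> are cylinders and the others have mass 0 on both sides.\<close>

lemma distr_path:
  "distr (M i) (count_space UNIV) (\<lambda>\<omega>. map (\<lambda>k. \<Phi> k \<omega>) [0..<Suc n]) = measure_pmf (path_pmf kernel n i)"
    (is "?D = _")
proof (rule measure_eqI_countable[of _ UNIV])
  interpret prob_space "M i" by (rule prob_space_M)
  fix xs :: "nat list"
  have "emeasure ?D {xs} = ennreal (prob {\<omega> \<in> space (M i). map (\<lambda>k. \<Phi> k \<omega>) [0..<Suc n] = xs})"
    by (subst emeasure_distr[OF measurable_path])
       (auto simp: emeasure_eq_measure intro!: arg_cong[where f = prob] simp del: upt_Suc)
  also have "prob {\<omega> \<in> space (M i). map (\<lambda>k. \<Phi> k \<omega>) [0..<Suc n] = xs} = pmf (path_pmf kernel n i) xs"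
  proof (cases "length xs = Suc n")
    case True
    then have xs: "map ((!) xs) [0..<Suc n] = xs"
      using map_nth[of xs] by (simp only:)
    have "{\<omega> \<in> space (M i). map (\<lambda>k. \<Phi> k \<omega>) [0..<Suc n] = xs} = {\<omega> \<in> space (M i). \<forall>k\<le>n. \<Phi> k \<omega> = xs ! k}"
      using True by (simp only: map_upt_eq_iff less_Suc_eq_le simp_thms)
    then show ?thesis
      using cylinder_prob[of i n "(!) xs"] pmf_path_pmf[of kernel n i "(!) xs"]
      by (simp only: xs pmf_kernel)
  next
    case False
    then have "{\<omega> \<in> space (M i). map (\<lambda>k. \<Phi> k \<omega>) [0..<Suc n] = xs} = {}"
      by (auto simp del: upt_Suc)
    moreover have "pmf (path_pmf kernel n i) xs = 0"
      using False path_pmf_support[of xs kernel n i] by (auto simp: set_pmf_iff)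
    ultimately show ?thesis
      by (simp only: measure_empty)
  qed
  finally show "emeasure ?D {xs} = emeasure (measure_pmf (path_pmf kernel n i)) {xs}"
    by (simp add: emeasure_pmf_single)
qed auto

lemma prob_path:
  "\<P>(\<omega> in M i. Q (map (\<lambda>k. \<Phi> k \<omega>) [0..<Suc n])) = path_prob kernel n i Q"
  unfolding path_prob_def distr_path[symmetric]
  by (subst measure_distr[OF measurable_path]) (auto intro!: arg_cong[where f = "measure (M i)"] simp del: upt_Suc)

lemma path_prob_kernel_Suc:
  "path_prob kernel (Suc n) i Q = (\<Sum>j\<le>Suc i. P i j * path_prob kernel n j (\<lambda>xs. Q (i # xs)))"
  using path_prob_Suc[OF finite_atMost set_pmf_kernel] by (simp only: pmf_kernel)

lemma nstep_singleton: "nstep M \<Phi> n i {y} = mat_power P n i y"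
proof -
  have "path_prob kernel n i (\<lambda>xs. xs ! n = y) = mat_power P n i y"
  proof (induction n arbitrary: i)
    case (Suc n)
    then show ?case
      by (simp add: path_prob_kernel_Suc mat_power_Suc del: mat_power.simps(2) sum.atMost_Suc)
  qed (simp add: path_prob_0)
  then show ?thesis
    unfolding prob_path[symmetric] by (simp add: nstep_def del: upt_Suc)
qed

lemma prob_hit_time_eq: "\<P>(\<omega> in M i. hit_time \<Phi> y \<omega> = enat (Suc n)) = first_passage P y n i"
proof -
  let ?H = "\<lambda>n xs. xs ! Suc n = y \<and> (\<forall>k\<in>{1..n}. xs ! k \<noteq> y)"
  \<comment> \<open>The form of \<open>?H\<close> after the start is dropped: the initial state of a
    return path may be \<open>y\<close>, but the states that follow, index 0 included here, may
    not.\<close>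
  let ?H' = "\<lambda>n xs. xs ! n = y \<and> (\<forall>k<n. xs ! k \<noteq> y)"
  have cons: "?H n (i # xs) \<longleftrightarrow> ?H' n xs" for n i and xs :: "nat list"
    unfolding image_Suc_lessThan[symmetric] by auto
  have step: "path_prob kernel (Suc n) i (?H n) = (\<Sum>j\<le>Suc i. P i j * path_prob kernel n j (?H' n))" for n i
    unfolding path_prob_kernel_Suc cons ..
  have "path_prob kernel (Suc n) i (?H n) = first_passage P y n i" for n i
  proof (induction n arbitrary: i)
    case 0
    show ?case
      unfolding step row_split[where y = y] by (simp add: path_prob_0)
  next
    case (Suc n)
    \<comment> \<open>A first step to \<open>y\<close> comes too early and has no share; from any
      other \<open>j\<close> the condition at index 0 holds automatically, which leaves the event of
      the induction hypothesis.\<close>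
    have "path_prob kernel (Suc n) j (?H' (Suc n)) = (if j = y then 0 else first_passage P y n j)" for j
    proof (cases "j = y")
      case True
      have "path_prob kernel (Suc n) j (?H' (Suc n)) = path_prob kernel (Suc n) j (\<lambda>_. False)"
        by (rule path_prob_cong) (use True in auto)
      then show ?thesis
        using True by (simp add: path_prob_def)
    next
      case False
      have "path_prob kernel (Suc n) j (?H' (Suc n)) = path_prob kernel (Suc n) j (?H n)"
        by (rule path_prob_cong)
           (auto simp: False All_less_Suc2 simp flip: image_Suc_lessThan[unfolded One_nat_def])
      then show ?thesis
        using False Suc.IH by simp
    qed
    then show ?case
      unfolding step row_split[where y = y] by simp
  qed
  moreover have "\<P>(\<omega> in M i. hit_time \<Phi> y \<omega> = enat (Suc n)) = path_prob kernel (Suc n) i (?H n)"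
    unfolding prob_path[symmetric] hit_time_eq_Suc_iff
    by (intro arg_cong[where f = "measure (M i)"] Collect_cong) (auto simp del: upt_Suc)
  ultimately show ?thesis by simp
qed

lemma first_hit_Suc: "first_hit M \<Phi> i (Suc n) = first_passage P 0 n i"
  by (simp add: first_hit_def prob_hit_time_eq)

lemma sums_prob_hit_time_finite:
  "(\<lambda>n. first_passage P y n i) sums \<P>(\<omega> in M i. hit_time \<Phi> y \<omega> < \<infinity>)"
proof -
  interpret prob_space "M i" by (rule prob_space_M)
  let ?A = "\<lambda>n. {\<omega> \<in> space (M i). hit_time \<Phi> y \<omega> = enat (Suc n)}"
  have "?A n \<in> sets (M i)" for n
    unfolding hit_time_eq_Suc_iff by measurable
  then have "(\<lambda>n. prob (?A n)) sums prob (\<Union>n. ?A n)"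
    by (intro finite_measure_UNION) (auto simp: disjoint_family_on_def)
  moreover have "(\<Union>n. ?A n) = {\<omega> \<in> space (M i). hit_time \<Phi> y \<omega> < \<infinity>}"
    using hit_time_finite_iff[of \<Phi> y] by blast
  ultimately show ?thesis
    by (simp add: prob_hit_time_eq)
qed

end

subsection \<open>Moments of the hitting time\<close>

lemma pochhammer_shift:
  "pochhammer (z + 1) (Suc m) = pochhammer z (Suc m) + of_nat (Suc m) * pochhammer (z + 1) m"
  for z :: "'a::comm_semiring_1"
  by (subst pochhammer_Suc, subst pochhammer_rec) (simp add: algebra_simps)

lemma power_le_pochhammer: "0 < z \<Longrightarrow> z ^ l \<le> pochhammer z l" for z :: real
  by (induction l) (auto simp: pochhammer_Suc power_Suc2 simp del: power_Suc intro!: mult_mono pochhammer_nonneg)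

lemma pochhammer_le_power:
  fixes z :: real
  assumes "1 \<le> z"
  shows "pochhammer z l \<le> fact l * z ^ l"
proof (induction l)
  case (Suc l)
  have "z + real l \<le> real (Suc l) * z"
    using mult_left_mono[OF assms, of "real l"] by (simp add: algebra_simps)
  then have "pochhammer z l * (z + real l) \<le> (fact l * z ^ l) * (real (Suc l) * z)"
    using assms by (intro mult_mono Suc.IH) auto
  then show ?case
    by (simp add: pochhammer_Suc algebra_simps)
qed simp

definition moment_term :: "(nat \<Rightarrow> nat \<Rightarrow> real) \<Rightarrow> nat \<Rightarrow> nat \<Rightarrow> nat \<Rightarrow> real" where
  "moment_term P l n i = pochhammer (real (Suc n)) l * first_passage P 0 n i"

text \<open>Chosen so that summation over \<open>n\<close> yields \<open>P i 0\<close> for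
  \<open>l = 0\<close>, and \<open>l\<close> times the moment of order \<open>l - 1\<close>
  otherwise.\<close>

definition moment_source :: "(nat \<Rightarrow> nat \<Rightarrow> real) \<Rightarrow> nat \<Rightarrow> nat \<Rightarrow> nat \<Rightarrow> real" where
  "moment_source P l n i =
    (if l = 0 then if n = 0 then P i 0 else 0 else real l * moment_term P (l - 1) n i)"

definition moment :: "(nat \<Rightarrow> nat \<Rightarrow> real) \<Rightarrow> nat \<Rightarrow> nat \<Rightarrow> real" where
  "moment P l i = (\<Sum>n. moment_term P l n i)"

context skip_free
begin

lemma moment_term_nonneg: "0 \<le> moment_term P l n i"
  by (auto simp: moment_term_def intro!: mult_nonneg_nonneg pochhammer_nonneg)

text \<open>A first step away from 0 shortens the passage time from \<open>n + 2\<close> to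
  \<open>n + 1\<close>, and \<open>pochhammer_shift\<close> turns the change of weight into the
  source. At time 1 the weights match because \<open>fact l = l * fact (l - 1)\<close>.\<close>

lemma killed_series_moment: "killed_series P (moment_term P l) (moment_source P l)"
proof
  show "moment_term P l 0 i = moment_source P l 0 i" for i
    by (cases l) (auto simp: moment_source_def moment_term_def pochhammer_Suc algebra_simps)
  show "0 \<le> moment_source P l n i" for n i
    by (auto simp: moment_source_def moment_term_nonneg)
  show "moment_term P l (Suc n) i
      = (\<Sum>k\<in>{..Suc i} - {0}. P i k * moment_term P l n k) + moment_source P l (Suc n) i" for n i
  proof (cases l)
    case 0
    then show ?thesis by (simp add: moment_source_def moment_term_def del: sum.atMost_Suc)
  next
    case (Suc m)
    have "(\<Sum>k\<in>{..Suc i} - {0}. P i k * moment_term P l n k)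
        = pochhammer (real (Suc n)) (Suc m) * first_passage P 0 (Suc n) i"
      using Suc by (simp add: moment_term_def sum_distrib_left mult_ac del: sum.atMost_Suc of_nat_Suc)
    moreover have "pochhammer (real (Suc (Suc n))) (Suc m)
        = pochhammer (real (Suc n)) (Suc m) + real (Suc m) * pochhammer (real (Suc (Suc n))) m"
      using pochhammer_shift[of "real (Suc n)" m] by (simp only: of_nat_Suc add.commute)
    ultimately show ?thesis
      unfolding moment_source_def moment_term_def[of P l "Suc n"] using Suc
      by (simp add: moment_term_def distrib_right mult.assoc del: of_nat_Suc first_passage.simps sum.atMost_Suc)
  qed
qed

lemma summable_moment_pred:
  assumes "summable (\<lambda>n. moment_term P (Suc l) n i)"
  shows "summable (\<lambda>n. moment_term P l n i)"
proof (rule summable_comparison_test'[OF assms, of 0])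
  fix n
  have "pochhammer (real (Suc n)) l * 1 \<le> pochhammer (real (Suc n)) (Suc l)"
    unfolding pochhammer_Suc by (intro mult_left_mono pochhammer_nonneg) auto
  then have "moment_term P l n i \<le> moment_term P (Suc l) n i"
    unfolding moment_term_def by (intro mult_right_mono) auto
  then show "norm (moment_term P l n i) \<le> moment_term P (Suc l) n i"
    using moment_term_nonneg[of l n i] by simp
qed

lemma moment_source_0_sums: "(\<lambda>n. moment_source P 0 n i) sums P i 0"
  using sums_single[of 0 "\<lambda>_. P i 0"] by (simp add: moment_source_def)

lemma moment_source_Suc_sums:
  assumes "summable (\<lambda>n. moment_term P l n i)"
  shows "(\<lambda>n. moment_source P (Suc l) n i) sums (real (Suc l) * moment P l i)"
  using sums_mult[OF summable_sums[OF assms]] by (simp add: moment_source_def moment_def)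

text \<open>The descent to state 1 uses a source with finite sum at all states from 1 on, which is
  the claim for the previous order; hence the induction on \<open>l\<close>.\<close>

lemma summable_moment_all:
  assumes "1 \<le> i" "summable (\<lambda>n. moment_term P l n i)" "1 \<le> k"
  shows "summable (\<lambda>n. moment_term P l n k)"
  using assms(2,3)
proof (induction l arbitrary: k)
  case 0
  interpret killed_series P "moment_term P 0" "moment_source P 0"
    by (rule killed_series_moment)
  show ?case
    by (rule summable_all[OF moment_source_0_sums assms(1) 0])
next
  case (Suc l)
  interpret killed_series P "moment_term P (Suc l)" "moment_source P (Suc l)"
    by (rule killed_series_moment)
  show ?case
    by (rule summable_all[OF moment_source_Suc_sums assms(1) Suc.prems])
       (rule Suc.IH[OF summable_moment_pred[OF Suc.prems(1)]])
qed

text \<open>From 0 the killed chain can only move to 1; the source at 0 is the previous moment at 0,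
  finite by induction.\<close>

lemma summable_moment_0_iff: "summable (\<lambda>n. moment_term P l n 0) \<longleftrightarrow> summable (\<lambda>n. moment_term P l n 1)"
proof (induction l)
  case 0
  interpret killed_series P "moment_term P 0" "moment_source P 0"
    by (rule killed_series_moment)
  show ?case
    using summable_upward[of 0] suminf_rec_0 moment_source_0_sums[of 0]
    by (auto simp: sums_iff)
next
  case (Suc l)
  interpret killed_series P "moment_term P (Suc l)" "moment_source P (Suc l)"
    by (rule killed_series_moment)
  show ?case
  proof
    assume 1: "summable (\<lambda>n. moment_term P (Suc l) n 1)"
    then have "summable (\<lambda>n. moment_term P l n 0)"
      using Suc.IH summable_moment_pred by blast
    from suminf_rec_0 1 moment_source_Suc_sums[OF this]
    show "summable (\<lambda>n. moment_term P (Suc l) n 0)"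
      by (auto simp: sums_iff)
  qed (use summable_upward[of 0] in simp)
qed

text \<open>Rising factorials lie between \<open>z ^ l\<close> and \<open>fact l * z ^ l\<close> for
  \<open>z \<ge> 1\<close>; the renewal argument works with the plain powers.\<close>

lemma summable_moment_iff_power:
  "summable (\<lambda>n. moment_term P l n i) \<longleftrightarrow> summable (\<lambda>n. real (Suc n) ^ l * first_passage P 0 n i)"
proof
  assume *: "summable (\<lambda>n. moment_term P l n i)"
  show "summable (\<lambda>n. real (Suc n) ^ l * first_passage P 0 n i)"
    by (rule summable_comparison_test'[OF *, of 0])
       (auto simp: moment_term_def abs_mult simp del: of_nat_Suc intro!: mult_right_mono power_le_pochhammer)
next
  assume "summable (\<lambda>n. real (Suc n) ^ l * first_passage P 0 n i)"
  then have *: "summable (\<lambda>n. fact l * (real (Suc n) ^ l * first_passage P 0 n i))"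
    by (rule summable_mult)
  show "summable (\<lambda>n. moment_term P l n i)"
  proof (rule summable_comparison_test'[OF *, of 0])
    fix n
    have "pochhammer (real (Suc n)) l \<le> fact l * real (Suc n) ^ l"
      by (rule pochhammer_le_power) simp
    then have "moment_term P l n i \<le> fact l * real (Suc n) ^ l * first_passage P 0 n i"
      unfolding moment_term_def by (rule mult_right_mono) simp
    then show "norm (moment_term P l n i) \<le> fact l * (real (Suc n) ^ l * first_passage P 0 n i)"
      using moment_term_nonneg[of l n i] by (simp add: mult.assoc)
  qed
qed

end

section \<open>Moments of the process as suprema\<close>

context skip_free_process
begin

lemma hit_moment_eq:
  "hit_moment M \<Phi> i l = (if summable (\<lambda>n. moment_term P l n i) then ereal (moment P l i) else \<infinity>)"
proof -
  have *: "hit_moment M \<Phi> i l = (\<Sum>n. ereal (moment_term P l n i))"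
    by (simp add: hit_moment_def first_hit_Suc moment_term_def)
  show ?thesis
  proof (cases "summable (\<lambda>n. moment_term P l n i)")
    case True
    then have "(\<lambda>n. ereal (moment_term P l n i)) sums ereal (moment P l i)"
      unfolding sums_ereal moment_def by (rule summable_sums)
    then show ?thesis
      using True * by (simp add: sums_iff)
  next
    case False
    then show ?thesis
      using * summable_real_of_ereal[of "\<lambda>n. ereal (moment_term P l n i)"] moment_term_nonneg by auto
  qed
qed

lemma hit_moment_nonneg: "0 \<le> hit_moment M \<Phi> i l"
  using moment_term_nonneg by (auto simp: hit_moment_eq moment_def intro: suminf_nonneg)

lemma summable_moment_0: "summable (\<lambda>n. moment_term P 0 n i)"
  using sums_prob_hit_time_finite[of 0 i] by (simp add: moment_term_def sums_iff)

text \<open>By \<open>green_coeff_absorption\<close> the ratios for the source \<open>P k 0\<close>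
  are those in \<open>xi\<close>, so \<open>xi\<close> is the probability of hitting 0 from
  1.\<close>

lemma xi_eq: "xi P = ereal (moment P 0 1)"
  and moment_0_eq:
    "1 \<le> i \<Longrightarrow> moment P 0 i = (\<Sum>j=0..<i. F_coeff P j 0) * moment P 0 1 - (\<Sum>j=1..<i. F_coeff P j 0)"
proof -
  interpret killed_series P "moment_term P 0" "moment_source P 0"
    by (rule killed_series_moment)
  have green: "(\<Sum>j=0..<i. green_coeff P (\<lambda>k. P k 0) j) = (\<Sum>j=1..<i. F_coeff P j 0)" if "1 \<le> i" for i
    using that by (simp add: sum.atLeast_Suc_lessThan green_coeff_absorption)
  show "1 \<le> i \<Longrightarrow> moment P 0 i = (\<Sum>j=0..<i. F_coeff P j 0) * moment P 0 1 - (\<Sum>j=1..<i. F_coeff P j 0)"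
    using suminf_profile[OF moment_source_0_sums summable_moment_0, of i] green[of i]
    by (simp add: moment_def)
  let ?r = "\<lambda>i. ereal ((\<Sum>j=1..<i. F_coeff P j 0) / (\<Sum>j=0..<i. F_coeff P j 0))"
  have "ereal (moment P 0 1)
      = (SUP i\<in>{1..}. ereal ((\<Sum>j=0..<i. green_coeff P (\<lambda>k. P k 0) j) / (\<Sum>j=0..<i. F_coeff P j 0)))"
    unfolding moment_def by (rule suminf_eq_SUP[OF moment_source_0_sums summable_moment_0])
  also have "\<dots> = (SUP i\<in>{1..}. ?r i)"
    by (intro SUP_cong) (auto simp: green)
  \<comment> \<open>The general supremum starts at 1, that of \<open>xi\<close> at 2; the extra
    ratio is 0 and lies below the one at 2.\<close>
  also have "{1..} = insert 1 {2::nat..}"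
    by auto
  also have "(SUP i\<in>insert 1 {2..}. ?r i) = sup (?r 1) (SUP i\<in>{2..}. ?r i)"
    by (rule SUP_insert)
  also have "\<dots> = (SUP i\<in>{2..}. ?r i)"
  proof (rule sup_absorb2)
    have "?r 1 \<le> ?r 2"
      using F_nonneg by (simp add: sum_nonneg)
    also have "\<dots> \<le> (SUP i\<in>{2..}. ?r i)"
      by (rule SUP_upper) simp
    finally show "?r 1 \<le> (SUP i\<in>{2..}. ?r i)" .
  qed
  finally show "xi P = ereal (moment P 0 1)"
    by (simp add: xi_def)
qed

lemma moment_0_0: "moment P 0 0 = P 0 1 * moment P 0 1 + P 0 0"
proof -
  interpret killed_series P "moment_term P 0" "moment_source P 0"
    by (rule killed_series_moment)
  show ?thesis
    using suminf_rec_0 summable_moment_0 moment_source_0_sums[of 0]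
    by (auto simp: sums_iff moment_def)
qed

lemma d_coeff_eq:
  assumes "\<And>k. 1 \<le> k \<Longrightarrow> summable (\<lambda>n. moment_term P l n k)"
  shows "d_coeff P M \<Phi> (Suc l) j = ereal (green_coeff P (moment P l) j)"
  unfolding d_coeff_def green_coeff_def sum_ereal[symmetric]
  using assms upward_pos by (intro sum.cong) (auto simp: hit_moment_eq less_imp_neq[symmetric])

lemma green_coeff_cmult: "green_coeff P (\<lambda>k. c * g k) j = c * green_coeff P g j"
  by (simp add: green_coeff_def sum_distrib_left mult_ac)

text \<open>All ratios are nonnegative, so the factor \<open>Suc l\<close> moves inside the supremum
  and into the source. The result is the supremum that governs the moment of order
  \<open>Suc l\<close> at state 1.\<close>

lemma sigma2_eq:
  assumes "\<And>k. 1 \<le> k \<Longrightarrow> summable (\<lambda>n. moment_term P l n k)"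
  shows "sigma2 P M \<Phi> (Suc l) = (SUP i\<in>{1..}. ereal
    ((\<Sum>j=0..<i. green_coeff P (\<lambda>k. real (Suc l) * moment P l k) j) / (\<Sum>j=0..<i. F_coeff P j 0)))"
proof -
  have nonneg: "0 \<le> moment P l k" if "1 \<le> k" for k
    unfolding moment_def using assms[OF that] moment_term_nonneg by (intro suminf_nonneg)
  have "sigma2 P M \<Phi> (Suc l) = ereal (real (Suc l)) *
      (SUP i\<in>{1..}. ereal ((\<Sum>j=0..<i. green_coeff P (moment P l) j) / (\<Sum>j=0..<i. F_coeff P j 0)))"
    unfolding sigma2_def d_sup_def using F_sum_ge_1
    by (intro arg_cong[where f = "(*) _"] SUP_cong refl) (force simp: d_coeff_eq[OF assms])
  also have "\<dots> = (SUP i\<in>{1..}. ereal (real (Suc l)) *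
      ereal ((\<Sum>j=0..<i. green_coeff P (moment P l) j) / (\<Sum>j=0..<i. F_coeff P j 0)))"
    using nonneg F_nonneg
    by (intro SUP_ereal_mult_left[symmetric]) (auto intro!: divide_nonneg_nonneg sum_nonneg green_coeff_nonneg)
  finally show ?thesis
    by (simp add: green_coeff_cmult sum_distrib_left del: of_nat_Suc)
qed

lemma sigma2_infinite_iff: "1 \<le> l \<Longrightarrow> sigma2 P M \<Phi> l = \<infinity> \<longleftrightarrow> d_sup P M \<Phi> l = \<infinity>"
  by (cases "d_sup P M \<Phi> l") (auto simp: sigma2_def)

text \<open>An infinite moment at \<open>k\<close> makes the moment at 1 infinite, hence also
  \<open>d_coeff\<close> at 1, which first enters the ratio at \<open>i = 2\<close>.\<close>

lemma d_sup_infinite: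
  assumes "1 \<le> k" "\<not> summable (\<lambda>n. moment_term P l n k)"
  shows "d_sup P M \<Phi> (Suc l) = \<infinity>"
proof -
  have "hit_moment M \<Phi> 1 l = \<infinity>"
    using summable_moment_all[of 1 l k] assms by (auto simp: hit_moment_eq)
  then have "d_coeff P M \<Phi> (Suc l) 1 = \<infinity>"
    using upward_pos[of 1] by (simp add: d_coeff_def)
  then have "(\<Sum>j=0..<2. d_coeff P M \<Phi> (Suc l) j) = \<infinity>"
    by (simp add: numeral_2_eq_2 d_coeff_def[of _ _ _ _ 0])
  moreover have "0 < (\<Sum>j=0..<2. F_coeff P j 0)"
    using F_sum_ge_1[of 2] by linarith
  ultimately have "\<infinity> \<le> d_sup P M \<Phi> (Suc l)"
    unfolding d_sup_def by (intro SUP_upper2[of 2]) auto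
  then show ?thesis by simp
qed

text \<open>With finite moments of order \<open>l\<close> this is the supremum criterion; otherwise
  the moment of order \<open>Suc l\<close> and \<open>d_sup\<close> are both infinite.\<close>

lemma summable_moment_iff_d_sup:
  assumes "1 \<le> i"
  shows "summable (\<lambda>n. moment_term P (Suc l) n i) \<longleftrightarrow> d_sup P M \<Phi> (Suc l) \<noteq> \<infinity>"
proof (cases "\<forall>k\<ge>1. summable (\<lambda>n. moment_term P l n k)")
  case True
  interpret killed_series P "moment_term P (Suc l)" "moment_source P (Suc l)"
    by (rule killed_series_moment)
  have "summable (\<lambda>n. moment_term P (Suc l) n i) \<longleftrightarrow> (\<forall>k\<ge>1. summable (\<lambda>n. moment_term P (Suc l) n k))"
    using summable_moment_all assms by blast
  also have "\<dots> \<longleftrightarrow> sigma2 P M \<Phi> (Suc l) \<noteq> \<infinity>"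
    using True by (subst summable_iff_SUP_finite[OF moment_source_Suc_sums]) (auto simp: sigma2_eq)
  finally show ?thesis
    by (simp add: sigma2_infinite_iff)
next
  case False
  then obtain k where k: "1 \<le> k" "\<not> summable (\<lambda>n. moment_term P l n k)"
    by blast
  then have "\<not> summable (\<lambda>n. moment_term P (Suc l) n i)"
    using summable_moment_pred summable_moment_all assms by blast
  then show ?thesis
    using d_sup_infinite[OF k] by simp
qed

lemma hit_moment_Suc_formula:
  assumes "1 \<le> i"
  shows "hit_moment M \<Phi> i (Suc l) = (if d_sup P M \<Phi> (Suc l) = \<infinity> then \<infinity>
    else ereal (real (Suc l)) *
      (\<Sum>j=0..<i. ereal (F_coeff P j 0) * d_sup P M \<Phi> (Suc l) - d_coeff P M \<Phi> (Suc l) j))"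
proof (cases "d_sup P M \<Phi> (Suc l) = \<infinity>")
  case True
  then show ?thesis
    using summable_moment_iff_d_sup[OF assms, of l] by (simp add: hit_moment_eq)
next
  case False
  interpret killed_series P "moment_term P (Suc l)" "moment_source P (Suc l)"
    by (rule killed_series_moment)
  have summable_Suc: "summable (\<lambda>n. moment_term P (Suc l) n k)" if "1 \<le> k" for k
    using False summable_moment_iff_d_sup[OF that, of l] by simp
  then have summable_l: "summable (\<lambda>n. moment_term P l n k)" if "1 \<le> k" for k
    using that by (blast intro: summable_moment_pred)
  note sums = moment_source_Suc_sums[OF summable_l]
  have sigma2: "sigma2 P M \<Phi> (Suc l) = ereal (moment P (Suc l) 1)"
    using sigma2_eq[OF summable_l] suminf_eq_SUP[OF sums summable_Suc] by (simp only: moment_def[of P "Suc l"])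
  \<comment> \<open>A real \<open>sigma2\<close> with positive factor \<open>Suc l\<close> forces a
    real \<open>d_sup\<close>, so the extended-real differences become ordinary ones.\<close>
  then obtain d where d: "d_sup P M \<Phi> (Suc l) = ereal d" "real (Suc l) * d = moment P (Suc l) 1"
    by (cases "d_sup P M \<Phi> (Suc l)") (auto simp: sigma2_def)
  have "moment P (Suc l) i = (\<Sum>j=0..<i. F_coeff P j 0) * moment P (Suc l) 1
      - (\<Sum>j=0..<i. green_coeff P (\<lambda>k. real (Suc l) * moment P l k) j)"
    unfolding moment_def[of P "Suc l"] using suminf_profile[OF sums summable_Suc assms] .
  also have "\<dots> = real (Suc l) * (\<Sum>j=0..<i. F_coeff P j 0 * d - green_coeff P (moment P l) j)"
    unfolding green_coeff_cmult d(2)[symmetric]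
    by (simp only: sum_subtractf sum_distrib_left sum_distrib_right right_diff_distrib mult_ac)
  finally show ?thesis
    using summable_Suc[OF assms] by (simp add: hit_moment_eq d_coeff_eq[OF summable_l] d del: of_nat_Suc)
qed

lemma hit_moment_1_eq_sigma2: "hit_moment M \<Phi> 1 (Suc l) = sigma2 P M \<Phi> (Suc l)"
  unfolding hit_moment_Suc_formula[OF order_refl] by (simp add: sigma2_def d_coeff_def)

lemma hit_moment_0_Suc:
  "hit_moment M \<Phi> 0 (Suc l)
    = ereal (P 0 1) * sigma2 P M \<Phi> (Suc l) + ereal (real (Suc l)) * hit_moment M \<Phi> 0 l"
proof (cases "summable (\<lambda>n. moment_term P (Suc l) n 1)")
  case True
  then have 0: "summable (\<lambda>n. moment_term P (Suc l) n 0)" "summable (\<lambda>n. moment_term P l n 0)"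
    using summable_moment_0_iff summable_moment_pred by blast+
  interpret killed_series P "moment_term P (Suc l)" "moment_source P (Suc l)"
    by (rule killed_series_moment)
  have "moment P (Suc l) 0 = P 0 1 * moment P (Suc l) 1 + real (Suc l) * moment P l 0"
    using suminf_rec_0 True moment_source_Suc_sums[OF 0(2)]
    by (auto simp: sums_iff moment_def[of P "Suc l"])
  then show ?thesis
    using True 0 by (simp add: hit_moment_eq flip: hit_moment_1_eq_sigma2 del: of_nat_Suc)
next
  case False
  then have "\<not> summable (\<lambda>n. moment_term P (Suc l) n 0)"
    using summable_moment_0_iff by blast
  \<comment> \<open>Positivity of \<open>P 0 1\<close> rules out the convention that zero times
    infinity is 0, and the nonnegative second summand excludes a sum of opposite infinities.\<close>
  moreover have "ereal (P 0 1) * \<infinity> = \<infinity>"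
    using upward_pos[of 0] by simp
  moreover have "0 \<le> ereal (real (Suc l)) * hit_moment M \<Phi> 0 l"
    using hit_moment_nonneg by (intro ereal_0_le_mult) auto
  ultimately show ?thesis
    using False by (simp add: hit_moment_eq[of _ "Suc l"] flip: hit_moment_1_eq_sigma2 del: of_nat_Suc)
qed

section \<open>Transience criteria\<close>

lemma xi_less_1_iff: "xi P < 1 \<longleftrightarrow> moment P 0 0 < 1"
proof -
  \<comment> \<open>From 0 the chain stays or moves to 1, so the return probability to 0 is
    \<open>1 - P 0 1 * (1 - moment P 0 1)\<close>.\<close>
  have "P 0 0 = 1 - P 0 1"
    using row_sum_1[of 0] by simp
  then have "moment P 0 0 < 1 \<longleftrightarrow> P 0 1 * moment P 0 1 < P 0 1 * 1"
    unfolding moment_0_0 by simp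
  also have "\<dots> \<longleftrightarrow> moment P 0 1 < 1"
    using upward_pos[of 0] by (simp only: mult_less_cancel_left_pos One_nat_def)
  finally show ?thesis
    by (simp add: xi_eq one_ereal_def)
qed

lemma moment_0_eq_suminf: "moment P 0 i = (\<Sum>n. first_passage P 0 n i)"
  by (simp add: moment_def moment_term_def)

lemma transient_chain_iff: "transient_chain M \<Phi> \<longleftrightarrow> xi P < 1"
proof
  assume "transient_chain M \<Phi>"
  then have "\<P>(\<omega> in M 0. hit_time \<Phi> 0 \<omega> < \<infinity>) < 1"
    by (simp add: transient_chain_def)
  then show "xi P < 1"
    using sums_prob_hit_time_finite[of 0 0] by (simp only: xi_less_1_iff moment_0_eq_suminf sums_iff)
next
  assume "xi P < 1"
  then have "(\<Sum>n. first_passage P 0 n 0) < 1"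
    by (simp only: xi_less_1_iff moment_0_eq_suminf)
  moreover have "summable (\<lambda>n. first_passage P 0 n 0)"
    using sums_prob_hit_time_finite[of 0 0] by (simp add: sums_iff)
  \<comment> \<open>Exponent 0 gives plain summability of the return probabilities, which passes
    from state 0 to all states.\<close>
  ultimately have "summable (\<lambda>n. real n ^ 0 * mat_power P n 0 0)"
    by (intro summable_power_U) auto
  then have "summable (\<lambda>n. real n ^ 0 * mat_power P n i i)" for i
    by (rule summable_mat_power_transfer)
  then have "(\<Sum>n. first_passage P i n i) < 1" for i
    by (intro suminf_f_less_1) simp
  moreover have "(\<Sum>n. first_passage P i n i) = \<P>(\<omega> in M i. hit_time \<Phi> i \<omega> < \<infinity>)" for i
    using sums_prob_hit_time_finite[of i i] by (simp only: sums_iff)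
  ultimately show "transient_chain M \<Phi>"
    by (simp only: transient_chain_def simp_thms)
qed

lemma mat_power_le_nstep: "y \<in> A \<Longrightarrow> mat_power P n x y \<le> nstep M \<Phi> n x A"
proof -
  assume "y \<in> A"
  interpret prob_space "M x" by (rule prob_space_M)
  show ?thesis
    unfolding nstep_singleton[symmetric] nstep_def
    using \<open>y \<in> A\<close> by (intro finite_measure_mono) auto
qed

text \<open>A covering set that contains 0 dominates the returns to 0; conversely, solidarity makes
  every singleton uniformly transient, and the singletons cover the space.\<close>

lemma l_transient_chain_iff_mat_power:
  "l_transient_chain P M \<Phi> l \<longleftrightarrow> summable (\<lambda>n. real n ^ l * mat_power P n 0 0)"
proof
  assume "l_transient_chain P M \<Phi> l"
  then obtain A where A: "0 \<in> A" "uniformly_transient M \<Phi> l A"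
    unfolding l_transient_chain_def by (metis UNIV_I Union_iff)
  let ?a = "\<lambda>n. real (Suc n) ^ l * nstep M \<Phi> (Suc n) 0 A"
  have "(\<Sum>n. ereal (?a n)) \<le> (SUP x\<in>A. \<Sum>n. ereal (real (Suc n) ^ l * nstep M \<Phi> (Suc n) x A))"
    by (rule SUP_upper[OF A(1)])
  with A(2) have "(\<Sum>n. ereal (?a n)) \<noteq> \<infinity>"
    by (auto simp: uniformly_transient_def)
  moreover have nonneg: "0 \<le> ?a n" for n
    by (simp add: nstep_def)
  ultimately have a: "summable ?a"
    using summable_real_of_ereal[of "\<lambda>n. ereal (?a n)"] by auto
  have "summable (\<lambda>n. real (Suc n) ^ l * mat_power P (Suc n) 0 0)"
  proof (rule summable_comparison_test'[OF a, of 0])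
    show "norm (real (Suc n) ^ l * mat_power P (Suc n) 0 0) \<le> ?a n" for n
      using mult_left_mono[OF mat_power_le_nstep[OF A(1), of "Suc n" 0], of "real (Suc n) ^ l"]
      by (simp add: abs_mult del: of_nat_Suc mat_power.simps)
  qed
  then show "summable (\<lambda>n. real n ^ l * mat_power P n 0 0)"
    by (subst summable_Suc_iff[symmetric])
next
  assume "summable (\<lambda>n. real n ^ l * mat_power P n 0 0)"
  then have "summable (\<lambda>n. real n ^ l * mat_power P n i i)" for i
    by (rule summable_mat_power_transfer)
  then have *: "summable (\<lambda>n. real (Suc n) ^ l * mat_power P (Suc n) i i)" for i
    by (subst (asm) summable_Suc_iff[symmetric])
  have "uniformly_transient M \<Phi> l {i}" for i
    using summable_sums[OF *[of i], folded sums_ereal]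
    by (simp add: uniformly_transient_def nstep_singleton sums_iff del: of_nat_Suc mat_power.simps)
  then show "l_transient_chain P M \<Phi> l"
    unfolding l_transient_chain_def using irreducible
    by (intro conjI exI[of _ "range (\<lambda>i. {i})"]) auto
qed

text \<open>The renewal equivalence passes from returns to first returns at 0; the moment of the
  first return is finite together with the one at state 1, which is \<open>sigma2\<close>.\<close>

lemma l_transient_chain_iff:
  "l_transient_chain P M \<Phi> (Suc l) \<longleftrightarrow> xi P < 1 \<and> sigma2 P M \<Phi> (Suc l) < \<infinity>"
proof -
  have "l_transient_chain P M \<Phi> (Suc l) \<longleftrightarrow>
      summable (\<lambda>n. real (Suc n) ^ Suc l * first_passage P 0 n 0) \<and> (\<Sum>n. first_passage P 0 n 0) < 1"
    unfolding l_transient_chain_iff_mat_power by (rule summable_power_U_iff) simp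
  also have "\<dots> \<longleftrightarrow> summable (\<lambda>n. moment_term P (Suc l) n 1) \<and> xi P < 1"
    unfolding summable_moment_iff_power[symmetric] summable_moment_0_iff xi_less_1_iff moment_0_eq_suminf ..
  also have "summable (\<lambda>n. moment_term P (Suc l) n 1) \<longleftrightarrow> sigma2 P M \<Phi> (Suc l) < \<infinity>"
    unfolding hit_moment_1_eq_sigma2[symmetric] by (simp add: hit_moment_eq)
  finally show ?thesis by blast
qed

end

theorem theorem4p6:
  fixes P :: "nat \<Rightarrow> nat \<Rightarrow> real"
    and M :: "nat \<Rightarrow> 'w measure"
    and \<Phi> :: "nat \<Rightarrow> 'w \<Rightarrow> nat"
  assumes "stochastic P"
    and "irreducible_matrix P"
    and "\<And>i j. j \<ge> i + 2 \<Longrightarrow> P i j = 0"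
    and "markov_chain P M \<Phi>"
  shows "(\<forall>i\<ge>1. hit_moment M \<Phi> i 0 =
            ereal (\<Sum>j=0..<i. F_coeff P j 0) * xi P - ereal (\<Sum>j=1..<i. F_coeff P j 0)) \<and>
         (\<forall>i\<ge>1. \<forall>l\<ge>1. hit_moment M \<Phi> i l =
            (if d_sup P M \<Phi> l = \<infinity> then \<infinity>
             else ereal (real l) *
               (\<Sum>j=0..<i. ereal (F_coeff P j 0) * d_sup P M \<Phi> l - d_coeff P M \<Phi> l j))) \<and>
         hit_moment M \<Phi> 0 0 = ereal (P 0 1) * xi P + ereal (P 0 0) \<and>
         (\<forall>l\<ge>1. hit_moment M \<Phi> 0 l =
            ereal (P 0 1) * sigma2 P M \<Phi> l + ereal (real l) * hit_moment M \<Phi> 0 (l - 1)) \<and>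
         (transient_chain M \<Phi> \<longleftrightarrow> xi P < 1) \<and>
         (\<forall>l\<ge>1. l_transient_chain P M \<Phi> l \<longleftrightarrow> xi P < 1 \<and> sigma2 P M \<Phi> l < \<infinity>)"
proof -
  interpret skip_free_process P M \<Phi>
    by unfold_locales (use assms in auto)
  have pos: "\<exists>m. l = Suc m" if "1 \<le> l" for l :: nat
    using that by (cases l) auto
  have "hit_moment M \<Phi> i 0 =
      ereal (\<Sum>j=0..<i. F_coeff P j 0) * xi P - ereal (\<Sum>j=1..<i. F_coeff P j 0)" if "1 \<le> i" for i
    using moment_0_eq[OF that] by (simp add: hit_moment_eq summable_moment_0 xi_eq)
  moreover have "hit_moment M \<Phi> 0 0 = ereal (P 0 1) * xi P + ereal (P 0 0)"
    by (simp add: hit_moment_eq summable_moment_0 xi_eq moment_0_0)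
  moreover have "hit_moment M \<Phi> 0 l =
      ereal (P 0 1) * sigma2 P M \<Phi> l + ereal (real l) * hit_moment M \<Phi> 0 (l - 1)" if "1 \<le> l" for l
    using pos[OF that] hit_moment_0_Suc by (metis diff_Suc_1)
  moreover have "l_transient_chain P M \<Phi> l \<longleftrightarrow> xi P < 1 \<and> sigma2 P M \<Phi> l < \<infinity>" if "1 \<le> l" for l
    using pos[OF that] l_transient_chain_iff by blast
  ultimately show ?thesis
    using hit_moment_Suc_formula transient_chain_iff pos by blast
qed

end
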